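(* Let $b>0$ be an integer and $\xi$ a primitive $b$-th root of unity, and let $0\leq\theta<\frac{\pi}{2}$. (1) Assume $\xi\neq 1$. As $z\to0$ in $D_\theta$, $$F_1(\xi;e^{-z})=\frac{1}{\sqrt{1-\xi}}\,e^{-\frac{\xi\Phi(\xi,2,1)}{z}}\left(1+O(|z|)\right).$$ (2) Suppose $b$ is an odd prime, $\xi=e^{\frac{2\pi i a}{b}}$ (with $a$ an integer), $t\in\mathbb{N}$, $q=e^{\frac{2\pi i}{k}(h+iz)}$ with integers $0\leq h<k$, $\gcd(h,k)=1$, and $z\in\mathbb{C}$ with $\mathrm{Re}(z)>0$. Then as $z\to0$, $$F_2(\xi;q^t)\sim\omega^{-1}_{\frac{hbt+ak}{\lambda_{t,a,b,h,k}},\frac{kb}{\lambda_{t,a,b,h,k}}}\left(\frac{\lambda_{t,a,b,h,k}}{tbz}\right)^{\frac12}e^{-\frac{\pi\lambda_{t,a,b,h,k}^2}{12b^2ktz}}.$$ (3) As $z\to0$ in $D_\theta$, $$F_3(\xi;e^{-z})=\frac{\sqrt{2\pi}\,(b^2z)^{\frac12-\frac1b}}{\Gamma\left(\frac1b\right)}\prod_{j=1}^{b-1}\frac{1}{(1-\xi^j)^{\frac jb}}\,e^{-\frac{\pi^2}{6b^2z}}\left(1+O(|z|)\right).$$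
   Context: For $|q|<1$: $F_1(\xi;q):=\prod_{n\geq1}(1-\xi q^n)$, $F_2(\xi;q):=\prod_{n\geq1}(1-(\xi q)^n)$, $F_3(\xi;q):=\prod_{n\geq1}(1-\xi^{-1}(\xi q)^n)$. Lerch's transcendent is $\Phi(z,s,a):=\sum_{n\geq0}\frac{z^n}{(n+a)^s}$. $D_\theta:=\{re^{i\alpha}: r\geq0,\ |\alpha|\leq\theta\}$. For $x\in\mathbb{R}$, $((x)):=x-\lfloor x\rfloor-\frac12$ if $x\notin\mathbb{Z}$ and $((x)):=0$ if $x\in\mathbb{Z}$. For coprime $h,k\in\mathbb{N}$ (with $k\ge1$, $h$ any integer), the Dedekind sum is $s(h,k):=\sum_{\mu\pmod k}((\frac{\mu}{k}))((\frac{h\mu}{k}))$ and $\omega_{h,k}:=\exp(\pi i\, s(h,k))$; for arbitrary positive integers $m,n$, $\omega_{m,n}:=\omega_{m/\gcd(m,n),\,n/\gcd(m,n)}$. Further $$\lambda_{t,a,b,h,k}:=\gcd(k,t)\cdot\begin{cases}1&\text{if } k=1 \text{ or } \left(k>1 \text{ and } b\nmid \tfrac{k}{\gcd(k,t)}\right),\\ b&\text{if } b\mid\tfrac{k}{\gcd(k,t)} \text{ and } \tfrac{ht}{\gcd(k,t)}+a\tfrac{k}{b\gcd(k,t)}\not\equiv0\pmod b,\\ b^2&\text{if } b\mid\tfrac{k}{\gcd(k,t)} \text{ and } \tfrac{ht}{\gcd(k,t)}+a\tfrac{k}{b\gcd(k,t)}\equiv0\pmod b.\end{cases}$$ Square roots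 and powers are principal branches.
   Formalization: In (2), z tends to 0 inside D_θ for the fixed arbitrary θ<π/2, as in (1) and (3); for unrestricted approach in Re(z)>0 the claim fails, since F_2 tends to 0 as z tends to suitable nonzero points of the imaginary axis arbitrarily near 0 while the right side does not. *)

theory Defs
  imports
    "HOL-Analysis.Analysis"
    "HOL-Library.Landau_Symbols"
    "HOL-Number_Theory.Cong"
begin

text \<open>The products over \<open>n \<ge> 1\<close> are indexed from \<open>0\<close>, hence the \<^const>\<open>Suc\<close>.\<close>

definition F1 :: "complex \<Rightarrow> complex \<Rightarrow> complex" where
  "F1 \<xi> q = (\<Prod>n. 1 - \<xi> * q ^ Suc n)"

definition F2 :: "complex \<Rightarrow> complex \<Rightarrow> complex" where
  "F2 \<xi> q = (\<Prod>n. 1 - (\<xi> * q) ^ Suc n)"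

definition F3 :: "complex \<Rightarrow> complex \<Rightarrow> complex" where
  "F3 \<xi> q = (\<Prod>n. 1 - inverse \<xi> * (\<xi> * q) ^ Suc n)"

definition lerch_phi :: "complex \<Rightarrow> complex \<Rightarrow> complex \<Rightarrow> complex" where
  "lerch_phi z s a = (\<Sum>n. z ^ n / (of_nat n + a) powr s)"

definition sector :: "real \<Rightarrow> complex set" where
  "sector \<theta> = {rcis r \<alpha> | r \<alpha>. 0 \<le> r \<and> \<bar>\<alpha>\<bar> \<le> \<theta>}"

definition primitive_unity_root :: "nat \<Rightarrow> complex \<Rightarrow> bool" where
  "primitive_unity_root b \<xi> \<longleftrightarrow> 0 < b \<and> \<xi> ^ b = 1 \<and> (\<forall>d. 0 < d \<and> d < b \<longrightarrow> \<xi> ^ d \<noteq> 1)"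

definition sawtooth :: "real \<Rightarrow> real" where
  "sawtooth x = (if x \<in> \<int> then 0 else x - of_int \<lfloor>x\<rfloor> - 1 / 2)"

definition dedekind_sum :: "int \<Rightarrow> nat \<Rightarrow> real" where
  "dedekind_sum h k =
     (\<Sum>\<mu><k. sawtooth (real \<mu> / real k) * sawtooth (of_int (h * int \<mu>) / real k))"

text \<open>
  The multiplier for an arbitrary (not necessarily coprime) pair. The first argument is an
  arbitrary integer, since \<open>s(h,k)\<close> makes sense for every integer \<open>h\<close> coprime to \<open>k\<close>
  (including \<open>h = 0\<close>, \<open>k = 1\<close>). The integer divisions are exact.
\<close>

definition omega :: "int \<Rightarrow> nat \<Rightarrow> complex" where
  "omega m n =
     (let g = gcd m (int n)
      in exp (of_real pi * \<i> * of_real (dedekind_sum (m div g) (n div nat g))))"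

text \<open>
  Every division below is exact in the branch where it is evaluated.
\<close>

definition lambda_mult :: "nat \<Rightarrow> int \<Rightarrow> nat \<Rightarrow> nat \<Rightarrow> nat \<Rightarrow> nat" where
  "lambda_mult t a b h k =
     (let g = gcd k t in
      g * (if k = 1 \<or> (k > 1 \<and> \<not> b dvd k div g) then 1
           else if \<not> [int (h * t div g) + a * int (k div (b * g)) = 0] (mod int b) then b
           else b ^ 2))"

end

theory Submission
  imports Defs "HOL-Complex_Analysis.Complex_Analysis" "HOL-Real_Asymp.Real_Asymp"
begin

text \<open>
  Sorting the factors by the residue of their index turns each of the three products into a finite
  product of functions \<open>\<Prod>m\<ge>0. 1 - a * exp (- (m + x) * w)\<close> with \<open>\<bar>a\<bar> = 1\<close> and \<open>0 < x \<le> 1\<close>.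
  First-order Euler--Maclaurin summation of \<open>f u = Ln (1 - a * exp (- u))\<close>, whose antiderivative is
  the dilogarithm of \<open>a * exp (- u)\<close>, gives the behaviour of such a function when \<open>a \<noteq> 1\<close>. When
  \<open>a = 1\<close> one subtracts \<open>Ln u\<close> from \<open>f u\<close> first and sums \<open>Ln ((m + x) * w)\<close> by Stirling's formula,
  which brings in \<open>Gamma x\<close>. The dilogarithms at all \<open>K\<close>-th roots of unity add up to \<open>pi\<^sup>2 / (6 * K)\<close>,
  and the arguments of the numbers \<open>1 - \<zeta> ^ r\<close> combine to a Dedekind sum.
\<close>

subsection \<open>First-order Euler--Maclaurin summation\<close>

text \<open>No logarithm of an infinite product is taken. Logarithms of finitely many factors are
  summed and exponentiated, and the limit is passed to the products, so branch questions arise only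
  for single numbers in the right half-plane. One summation step has an error of order |w|^2 / (1 +
  m Re w)^2, and summing over m costs a factor 1 / Re w. This is comparable to 1 / |w| only in a
  sector strictly inside the right half-plane: here \<theta> < pi / 2 enters, and the total error
  becomes O(|w|). Stirling's formula is not presupposed. For a = 1 the partial products differ by a
  convergent factor from a quotient that does not involve w, so their convergence produces the
  Stirling constants as limits. The dependence on x is Gauss's product for 1 / Gamma; the absolute
  constant sqrt (2 pi) comes from duplication. The three cases of \<open>lambda_mult\<close>
  describe one gcd, the one that reduces a / b + h t / k = (h b t + a k) / (k b) to lowest terms.
  Thus \<open>F2\<close> at q^t is an Euler product near a single primitive root of unity.\<close>

definition wedge :: "real \<Rightarrow> complex set" where
  "wedge c = {u. c * norm u \<le> Re u}"

lemma zero_in_wedge [simp]: "0 \<in> wedge c"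
  by (simp add: wedge_def)

lemma wedge_add: "0 \<le> c \<Longrightarrow> u \<in> wedge c \<Longrightarrow> v \<in> wedge c \<Longrightarrow> u + v \<in> wedge c"
  unfolding wedge_def
  by (smt (verit) mem_Collect_eq norm_triangle_ineq mult_left_mono distrib_left plus_complex.sel(1))

lemma wedge_scale: "0 \<le> r \<Longrightarrow> u \<in> wedge c \<Longrightarrow> of_real r * u \<in> wedge c"
  unfolding wedge_def
  by (auto simp: norm_mult mult.left_commute[of c] intro: mult_left_mono)

lemma convex_wedge: "0 \<le> c \<Longrightarrow> convex (wedge c)"
  unfolding convex_def by (metis wedge_add wedge_scale scaleR_conv_of_real)

lemma wedge_Re_pos: "0 < c \<Longrightarrow> u \<in> wedge c \<Longrightarrow> u \<noteq> 0 \<Longrightarrow> 0 < Re u"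
  unfolding wedge_def by (smt (verit) mem_Collect_eq mult_pos_pos zero_less_norm_iff)

text \<open>Cosine decreases on [0, pi], so argument at most \<theta> in absolute value gives Re u
  >= cos \<theta> |u|. The linear inequality replaces arguments because it makes the region a convex
  cone on which |u| / Re u is bounded by 1 / c.\<close>

lemma sector_subset_wedge:
  assumes "0 \<le> \<theta>" "\<theta> < pi / 2"
  shows "sector \<theta> \<subseteq> wedge (cos \<theta>)"
proof
  fix u assume "u \<in> sector \<theta>"
  then obtain r \<alpha> where u: "u = rcis r \<alpha>" "0 \<le> r" "\<bar>\<alpha>\<bar> \<le> \<theta>"
    unfolding sector_def by blast
  have "cos \<theta> \<le> cos \<bar>\<alpha>\<bar>"
    using u assms by (intro cos_monotone_0_pi_le) auto
  then show "u \<in> wedge (cos \<theta>)"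
    using u by (simp add: wedge_def mult.commute mult_left_mono)
qed

text \<open>Expand at p: \<open>f\<close> to first order and \<open>F\<close> to second order. The
  weight x - 1/2, the first Bernoulli polynomial, is the one for which the main parts cancel: x -
  1/2 - (x - 1/2) = 0 in the coefficient of \<open>f1 p * w\<close>. The three remainders contribute
  1, 1/2 and 1/2 times B |w|^2.\<close>

lemma shifted_step_error:
  fixes F f f1 f2 :: "complex \<Rightarrow> complex"
  assumes S: "convex S"
    and dF: "\<And>u. u \<in> S \<Longrightarrow> (F has_field_derivative f u) (at u)"
    and df: "\<And>u. u \<in> S \<Longrightarrow> (f has_field_derivative f1 u) (at u)"
    and df1: "\<And>u. u \<in> S \<Longrightarrow> (f1 has_field_derivative f2 u) (at u)"
    and B: "\<And>u. u \<in> S \<Longrightarrow> norm (f2 u) \<le> B"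
    and p: "p \<in> S" "p + w \<in> S" and w: "w \<noteq> 0" and x: "0 \<le> x" "x \<le> 1"
  shows "norm (f (p + of_real x * w) - (F (p + w) - F p) / w
           - of_real (x - 1/2) * (f (p + w) - f p)) \<le> 2 * B * norm w ^ 2"
proof -
  have px: "p + of_real x * w \<in> S"
  proof -
    have "(1 - x) *\<^sub>R p + x *\<^sub>R (p + w) \<in> S"
      using S p x by (intro convexD) auto
    then show ?thesis by (simp add: scaleR_conv_of_real algebra_simps)
  qed
  have B0: "0 \<le> B" using B[OF p(1)] norm_ge_zero order_trans by blast
  define f3 where "f3 i = (if i = 0 then f else if i = 1 then f1 else f2)" for i :: nat
  define F4 where "F4 i = (if i = 0 then F else if i = 1 then f else if i = 2 then f1 else f2)" for i :: nat
  have T1: "norm (f z - (f p + f1 p * (z - p))) \<le> B * norm (z - p) ^ 2" if "z \<in> S" for z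
  proof -
    have "norm (f3 0 z - (\<Sum>i\<le>1. f3 i p * (z - p) ^ i / fact i)) \<le> B * norm (z - p) ^ Suc 1 / fact 1"
    proof (rule complex_Taylor[OF S _ _ p(1) that])
      show "(f3 i has_field_derivative f3 (Suc i) y) (at y within S)" if "y \<in> S" "i \<le> 1" for i y
        using that df df1 by (cases i) (auto simp: f3_def intro: has_field_derivative_at_within)
    qed (auto simp: f3_def B)
    then show ?thesis by (simp add: f3_def numeral_2_eq_2)
  qed
  have T2: "norm (F (p + w) - (F p + f p * w + f1 p * w ^ 2 / 2)) \<le> B * norm w ^ 3 / 2"
  proof -
    have "norm (F4 0 (p + w) - (\<Sum>i\<le>2. F4 i p * ((p + w) - p) ^ i / fact i)) \<le> B * norm ((p + w) - p) ^ Suc 2 / fact 2"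
    proof (rule complex_Taylor[OF S _ _ p(1) p(2)])
      show "(F4 i has_field_derivative F4 (Suc i) y) (at y within S)" if "y \<in> S" "i \<le> 2" for i y
      proof -
        from that have "i = 0 \<or> i = 1 \<or> i = 2" by auto
        then show ?thesis using that dF df df1
          by (auto simp: F4_def intro: has_field_derivative_at_within)
      qed
    qed (auto simp: F4_def B)
    then show ?thesis by (simp add: F4_def numeral_2_eq_2 numeral_3_eq_3)
  qed
  define a where "a = f (p + of_real x * w) - (f p + f1 p * (of_real x * w))"
  define b where "b = F (p + w) - (F p + f p * w + f1 p * w ^ 2 / 2)"
  define d where "d = f (p + w) - (f p + f1 p * w)"
  have eq: "f (p + of_real x * w) - (F (p + w) - F p) / w
           - of_real (x - 1/2) * (f (p + w) - f p) = a - b / w - of_real (x - 1/2) * d"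
    unfolding a_def b_def d_def using w by (simp add: field_simps power2_eq_square)
  have na: "norm a \<le> B * norm w ^ 2"
  proof -
    have "norm a \<le> B * norm (of_real x * w) ^ 2"
      using T1[OF px] by (simp add: a_def)
    also have "\<dots> \<le> B * norm w ^ 2"
      using x B0 by (intro mult_left_mono power_mono) (auto simp: norm_mult mult_left_le_one_le)
    finally show ?thesis .
  qed
  have nb: "norm (b / w) \<le> B * norm w ^ 2 / 2"
  proof -
    have "norm (b / w) = norm b / norm w" by (simp add: norm_divide)
    also have "\<dots> \<le> (B * norm w ^ 3 / 2) / norm w"
      using T2 by (intro divide_right_mono) (auto simp: b_def)
    also have "\<dots> = B * norm w ^ 2 / 2"
      using w by (simp add: power3_eq_cube power2_eq_square)
    finally show ?thesis .
  qed
  have nd: "norm (of_real (x - 1/2) * d) \<le> (1/2) * (B * norm w ^ 2)"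
  proof -
    have "\<bar>x - 1/2\<bar> \<le> 1/2" using x by (intro abs_leI) auto
    moreover have "norm d \<le> B * norm w ^ 2"
      using T1[OF p(2)] by (simp add: d_def)
    ultimately show ?thesis
      unfolding norm_mult norm_of_real by (intro mult_mono) auto
  qed
  have "norm (a - b / w - of_real (x - 1/2) * d) \<le> norm a + norm (b / w) + norm (of_real (x - 1/2) * d)"
    by (meson norm_triangle_ineq4 norm_triangle_le_diff add_mono order_trans order_refl)
  then show ?thesis unfolding eq using na nb nd by linarith
qed

text \<open>Telescoping comparison: with A = 1 + m a >= 1 one has A + a <= (1 + a) A, hence 1 / A^2
  <= (1 + a) / (A (A + a)), a difference of consecutive values of \<open>g\<close>. What matters is
  that the bound grows only like 1 / a as a tends to 0.\<close>

lemma inverse_square_progression: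
  fixes a :: real
  assumes "0 < a"
  shows "summable (\<lambda>m. 1 / (1 + real m * a)\<^sup>2)"
    and "(\<Sum>m. 1 / (1 + real m * a)\<^sup>2) \<le> (1 + a) / a"
proof -
  define g where "g m = ((1 + a) / a) * (1 / (1 + real m * a))" for m
  have "filterlim (\<lambda>m. 1 + real m * a) at_top sequentially"
    using assms by real_asymp
  then have "(\<lambda>m. 1 / (1 + real m * a)) \<longlonglongrightarrow> 0"
    by (rule tendsto_divide_0[OF tendsto_const filterlim_at_top_imp_at_infinity])
  then have "g \<longlonglongrightarrow> ((1 + a) / a) * 0"
    unfolding g_def by (intro tendsto_mult tendsto_const)
  then have g0: "g \<longlonglongrightarrow> 0" by simp
  have s: "(\<lambda>m. g m - g (Suc m)) sums (g 0 - 0)"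
    using telescope_sums'[OF g0] .
  have le: "1 / (1 + real m * a)\<^sup>2 \<le> g m - g (Suc m)" for m
  proof -
    define A where "A = 1 + real m * a"
    have A: "1 \<le> A" using assms by (simp add: A_def)
    have "g m - g (Suc m) = ((1 + a) / a) * (1 / A - 1 / (A + a))"
      by (simp add: g_def A_def algebra_simps)
    also have "\<dots> = (1 + a) / (A * (A + a))"
    proof -
      have "1 / A - 1 / (A + a) = a / (A * (A + a))"
        using A assms by (simp add: field_simps)
      then show ?thesis using assms by simp
    qed
    finally have eq: "g m - g (Suc m) = (1 + a) / (A * (A + a))" .
    have "A + a \<le> (1 + a) * A" using A assms by (simp add: algebra_simps)
    then have "(A + a) / (A\<^sup>2 * (A + a)) \<le> ((1 + a) * A) / (A\<^sup>2 * (A + a))"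
      using A assms by (intro divide_right_mono) auto
    then have "1 / A\<^sup>2 \<le> (1 + a) / (A * (A + a))"
      using A assms by (simp add: power2_eq_square)
    then show ?thesis unfolding eq A_def .
  qed
  show sm: "summable (\<lambda>m. 1 / (1 + real m * a)\<^sup>2)"
    by (rule summable_comparison_test'[OF sums_summable[OF s], of 0]) (use le in auto)
  have "(\<Sum>m. 1 / (1 + real m * a)\<^sup>2) \<le> (\<Sum>m. g m - g (Suc m))"
    by (intro suminf_le le sm sums_summable[OF s])
  also have "\<dots> = g 0 - 0" by (rule sums_unique[OF s, symmetric])
  also have "\<dots> = (1 + a) / a" by (simp add: g_def)
  finally show "(\<Sum>m. 1 / (1 + real m * a)\<^sup>2) \<le> (1 + a) / a" .
qed

text \<open>The defect of the step from m w to (m + 1) w. Both differences in it telescope over m,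
  which leaves boundary values at 0 and N w only.\<close>

definition em_error :: "(complex \<Rightarrow> complex) \<Rightarrow> (complex \<Rightarrow> complex) \<Rightarrow> real \<Rightarrow> complex \<Rightarrow> nat \<Rightarrow> complex" where
  "em_error F f x w m =
     f (of_real (real m + x) * w) - (F (of_nat (Suc m) * w) - F (of_nat m * w)) / w
       - of_real (x - 1/2) * (f (of_nat (Suc m) * w) - f (of_nat m * w))"

lemma sum_em_error:
  "(\<Sum>m<N. f (of_real (real m + x) * w)) =
     (F (of_nat N * w) - F 0) / w + of_real (x - 1/2) * (f (of_nat N * w) - f 0)
       + (\<Sum>m<N. em_error F f x w m)"
  by (induction N) (auto simp: em_error_def diff_divide_distrib algebra_simps)

text \<open>The functions to be summed may be branched at 0, so derivatives are assumed only away
  from 0 and mere limits at 0. For m > 0 the step estimate applies at p = m w. The first step starts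
  at the bad point and is reached as a limit of steps with base point near 0.\<close>

lemma em_error_le:
  fixes F f f1 f2 :: "complex \<Rightarrow> complex"
  assumes c: "0 < c"
    and dF: "\<And>u. u \<in> wedge c \<Longrightarrow> u \<noteq> 0 \<Longrightarrow> (F has_field_derivative f u) (at u)"
    and df: "\<And>u. u \<in> wedge c \<Longrightarrow> u \<noteq> 0 \<Longrightarrow> (f has_field_derivative f1 u) (at u)"
    and df1: "\<And>u. u \<in> wedge c \<Longrightarrow> u \<noteq> 0 \<Longrightarrow> (f1 has_field_derivative f2 u) (at u)"
    and B: "\<And>u. u \<in> wedge c \<Longrightarrow> u \<noteq> 0 \<Longrightarrow> norm (f2 u) \<le> C / (1 + Re u)\<^sup>2"
    and F0: "(F \<longlongrightarrow> F 0) (at 0 within wedge c)"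
    and f0: "(f \<longlongrightarrow> f 0) (at 0 within wedge c)"
    and C: "0 \<le> C" and w: "w \<in> wedge c" "w \<noteq> 0" and x: "0 < x" "x \<le> 1"
  shows "norm (em_error F f x w m) \<le> 2 * C * norm w ^ 2 * (1 / (1 + real m * Re w)\<^sup>2)"
proof -
  have Rw: "0 < Re w" using wedge_Re_pos[OF c w] .
  have step: "norm (f (p + of_real x * w) - (F (p + w) - F p) / w
           - of_real (x - 1/2) * (f (p + w) - f p)) \<le> 2 * (C / (1 + Re p)\<^sup>2) * norm w ^ 2"
    if p: "p \<in> wedge c" "p \<noteq> 0" for p
  \<comment> \<open>Cutting the wedge at Re p keeps the region convex, excludes 0, and makes the
    value at p the largest value of the bound C / (1 + Re u)^2.\<close>
  proof (rule shifted_step_error[where S = "wedge c \<inter> {u. Re p \<le> Re u}" and ?f1.0 = f1 and ?f2.0 = f2])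
    have Rp: "0 < Re p" using wedge_Re_pos[OF c p] .
    have nz: "u \<in> wedge c \<and> u \<noteq> 0" if "u \<in> wedge c \<inter> {u. Re p \<le> Re u}" for u
      using that Rp by auto
    show "convex (wedge c \<inter> {u. Re p \<le> Re u})"
      using c convex_halfspace_Re_ge[of "Re p"] by (intro convex_Int convex_wedge) auto
    show "(F has_field_derivative f u) (at u)" "(f has_field_derivative f1 u) (at u)"
       "(f1 has_field_derivative f2 u) (at u)" if "u \<in> wedge c \<inter> {u. Re p \<le> Re u}" for u
      using nz[OF that] dF df df1 by auto
    show "norm (f2 u) \<le> C / (1 + Re p)\<^sup>2" if u: "u \<in> wedge c \<inter> {u. Re p \<le> Re u}" for u
    proof -
      have "norm (f2 u) \<le> C / (1 + Re u)\<^sup>2" using nz[OF u] B by auto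
      also have "\<dots> \<le> C / (1 + Re p)\<^sup>2"
        using u Rp C by (intro divide_left_mono power_mono mult_pos_pos) auto
      finally show ?thesis .
    qed
  qed (use p w x c Rw in \<open>auto intro: wedge_add\<close>)
  show ?thesis
  proof (cases "m = 0")
    case False
    have "of_nat m * w \<in> wedge c" using wedge_scale[OF _ w(1), of "real m"] by simp
    from step[OF this] False w
    show ?thesis by (simp add: em_error_def algebra_simps)
  next
    case True
    \<comment> \<open>Base points tending to 0 inside the wedge; the step estimate holds at each
      with the uniform bound 2 C |w|^2, which survives the limit.\<close>
    define p where "p n = of_real (1 / real (Suc n)) * w" for n
    have pw: "p n \<in> wedge c" "p n \<noteq> 0" for n
    proof -
      show "p n \<in> wedge c" unfolding p_def by (rule wedge_scale) (use w in auto)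
      show "p n \<noteq> 0" using w by (simp add: p_def del: of_nat_Suc)
    qed
    have "(\<lambda>n. complex_of_real (1 / real (Suc n)) * w) \<longlonglongrightarrow> of_real 0 * w"
      by (intro tendsto_intros LIMSEQ_Suc[OF lim_1_over_n])
    then have p0: "p \<longlonglongrightarrow> 0" unfolding p_def[symmetric] by simp
    then have "filterlim p (at 0 within wedge c) sequentially"
      using pw by (auto simp: filterlim_at)
    then have l1: "(\<lambda>n. F (p n)) \<longlonglongrightarrow> F 0" "(\<lambda>n. f (p n)) \<longlonglongrightarrow> f 0"
      using F0 f0 by (auto intro: filterlim_compose)
    have xw: "of_real x * w \<in> wedge c" "of_real x * w \<noteq> 0"
      using w x by (auto intro!: wedge_scale)
    have pl: "(\<lambda>n. p n + v) \<longlonglongrightarrow> v" for v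
      using tendsto_add[OF p0 tendsto_const[of v]] by simp
    have l2: "(\<lambda>n. F (p n + v)) \<longlonglongrightarrow> F v" "(\<lambda>n. f (p n + v)) \<longlonglongrightarrow> f v"
      if "v \<in> wedge c" "v \<noteq> 0" for v
      using that dF df
      by (auto intro!: isCont_tendsto_compose[OF _ pl] DERIV_isCont)
    have "(\<lambda>n. norm (f (p n + of_real x * w) - (F (p n + w) - F (p n)) / w
           - of_real (x - 1/2) * (f (p n + w) - f (p n)))) \<longlonglongrightarrow>
          norm (f (of_real x * w) - (F w - F 0) / w - of_real (x - 1/2) * (f w - f 0))"
      using w xw by (intro tendsto_intros l1 l2) auto
    moreover have "norm (f (p n + of_real x * w) - (F (p n + w) - F (p n)) / w
           - of_real (x - 1/2) * (f (p n + w) - f (p n))) \<le> 2 * C * norm w ^ 2" for n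
    proof -
      have "1 \<le> (1 + Re (p n))\<^sup>2" using wedge_Re_pos[OF c pw] by (simp add: one_le_power less_imp_le)
      then have "C / (1 + Re (p n))\<^sup>2 \<le> C / 1" using C by (intro divide_left_mono) auto
      then have "2 * (C / (1 + Re (p n))\<^sup>2) * norm w ^ 2 \<le> 2 * C * norm w ^ 2"
        by (intro mult_right_mono) auto
      with step[OF pw] show ?thesis by (rule order_trans)
    qed
    ultimately have "norm (f (of_real x * w) - (F w - F 0) / w - of_real (x - 1/2) * (f w - f 0))
        \<le> 2 * C * norm w ^ 2"
      by (intro LIMSEQ_le_const2) auto
    then show ?thesis using True by (simp add: em_error_def)
  qed
qed

text \<open>On the wedge (1 + Re w) / Re w <= 2 / (c |w|) when |w| <= 1. Summation therefore
  consumes one of the two powers of |w|.\<close>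

lemma summable_em_error:
  assumes c: "0 < c" and C: "0 \<le> C" and w: "w \<in> wedge c" "w \<noteq> 0" "norm w \<le> 1"
    and le: "\<And>m. norm (em_error F f x w m) \<le> 2 * C * norm w ^ 2 * (1 / (1 + real m * Re w)\<^sup>2)"
  shows "summable (em_error F f x w)" "norm (suminf (em_error F f x w)) \<le> 4 * C / c * norm w"
proof -
  have Rw: "0 < Re w" using wedge_Re_pos[OF c w(1,2)] .
  have R1: "Re w \<le> 1" using complex_Re_le_cmod[of w] w by linarith
  note sq = inverse_square_progression[OF Rw]
  have sm: "summable (\<lambda>m. 2 * C * norm w ^ 2 * (1 / (1 + real m * Re w)\<^sup>2))"
    by (intro summable_mult sq)
  have sn: "summable (\<lambda>m. norm (em_error F f x w m))"
    by (rule summable_comparison_test'[OF sm, of 0]) (use le in auto)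
  then show "summable (em_error F f x w)" by (rule summable_norm_cancel)
  have "norm (suminf (em_error F f x w)) \<le> (\<Sum>m. norm (em_error F f x w m))"
    using sn by (rule summable_norm)
  also have "\<dots> \<le> (\<Sum>m. 2 * C * norm w ^ 2 * (1 / (1 + real m * Re w)\<^sup>2))"
    by (intro suminf_le le sn sm)
  also have "\<dots> = 2 * C * norm w ^ 2 * (\<Sum>m. 1 / (1 + real m * Re w)\<^sup>2)"
    by (rule suminf_mult[OF sq(1)])
  also have "\<dots> \<le> 2 * C * norm w ^ 2 * ((1 + Re w) / Re w)"
    using C by (intro mult_left_mono sq) auto
  also have "\<dots> \<le> 2 * C * norm w ^ 2 * (2 / (c * norm w))"
  proof -
    have "(1 + Re w) / Re w \<le> 2 / (c * norm w)"
      using R1 Rw w c by (intro frac_le) (auto simp: wedge_def)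
    then show ?thesis using C by (intro mult_left_mono) auto
  qed
  also have "\<dots> = 4 * C / c * norm w"
    using w c by (simp add: power2_eq_square field_simps)
  finally show "norm (suminf (em_error F f x w)) \<le> 4 * C / c * norm w" .
qed

subsection \<open>Dilogarithm and logarithm along the wedge\<close>

definition dilog :: "complex \<Rightarrow> complex" where
  "dilog y = (\<Sum>n. y ^ Suc n / of_nat (Suc n) ^ 2)"

lemma dilog_0 [simp]: "dilog 0 = 0"
  by (simp add: dilog_def)

lemma summable_inverse_Suc_square: "summable (\<lambda>n. 1 / real (Suc n) ^ 2)"
  using sums_summable[OF inverse_squares_sums] by (simp add: add.commute)

lemma norm_dilog_term_le: "norm y \<le> 1 \<Longrightarrow> norm (y ^ Suc n / of_nat (Suc n) ^ 2) \<le> 1 / real (Suc n) ^ 2"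
  for y :: complex
  unfolding norm_divide norm_power norm_of_nat by (intro divide_right_mono power_le_one) auto

lemma summable_dilog: "norm y \<le> 1 \<Longrightarrow> summable (\<lambda>n. y ^ Suc n / of_nat (Suc n) ^ 2)"
  for y :: complex
  by (rule summable_comparison_test'[OF summable_inverse_Suc_square, of 0])
     (use norm_dilog_term_le in blast)

text \<open>The closed disc is essential: the values needed are at roots of unity, on the circle of
  convergence, where the M-test with 1 / n^2 still applies.\<close>

lemma continuous_on_dilog: "continuous_on (cball 0 1) dilog"
proof -
  have "uniform_limit (cball 0 1) (\<lambda>N y. \<Sum>n<N. y ^ Suc n / of_nat (Suc n) ^ 2) dilog sequentially"
    unfolding dilog_def
    by (rule Weierstrass_m_test[OF _ summable_inverse_Suc_square]) (rule norm_dilog_term_le, simp)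
  then show ?thesis
    by (rule uniform_limit_theorem[rotated])
       (auto intro!: always_eventually continuous_intros simp del: of_nat_Suc)
qed

lemma DERIV_dilog:
  assumes y: "norm y < 1" "y \<noteq> 0"
  shows "(dilog has_field_derivative - Ln (1 - y) / y) (at y)"
proof -
  \<comment> \<open>Here \<open>c 0\<close> is 1 / 0 = 0, so starting the power series at index 0
    does not change its sum.\<close>
  define c where "c n = 1 / (of_nat n ^ 2 :: complex)" for n :: nat
  have sm: "summable (\<lambda>n. c n * y ^ n)" if "norm y \<le> 1" for y
    using summable_dilog[OF that] by (subst summable_Suc_iff[symmetric]) (simp add: c_def del: of_nat_Suc)
  have eq: "dilog y = (\<Sum>n. c n * y ^ n)" if "norm y \<le> 1" for y
    using suminf_split_head[OF sm[OF that]] by (simp add: dilog_def c_def)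
  have "summable (\<lambda>n. c n * 1 ^ n)" by (rule sm) simp
  from termdiffs_strong[OF this, of y] y
  have 1: "((\<lambda>y. \<Sum>n. c n * y ^ n) has_field_derivative (\<Sum>n. diffs c n * y ^ n)) (at y)"
    by simp
  have "(\<lambda>n. - ((- (- y)) ^ n) / of_nat n) sums ln (1 + - y)"
    by (rule Ln_series') (use y in simp)
  then have "(\<lambda>n. - (y ^ n) / of_nat n) sums Ln (1 - y)" by simp
  then have "(\<lambda>n. - (y ^ Suc n) / of_nat (Suc n)) sums Ln (1 - y)"
    by (subst sums_Suc_iff) simp
  from sums_divide[OF sums_minus[OF this], of y]
  have "(\<lambda>n. diffs c n * y ^ n) sums (- Ln (1 - y) / y)"
    using y by (simp add: diffs_def c_def field_simps power2_eq_square del: of_nat_Suc)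
  then have "(\<Sum>n. diffs c n * y ^ n) = - Ln (1 - y) / y" by (rule sums_unique[symmetric])
  with 1 have 2: "((\<lambda>y. \<Sum>n. c n * y ^ n) has_field_derivative - Ln (1 - y) / y) (at y)" by simp
  show ?thesis
    by (rule has_field_derivative_transform_within_open[OF 2 open_ball[of 0 1]])
       (use y eq in auto)
qed

lemma norm_unit_exp_less_1:
  fixes a :: complex assumes "norm a = 1" "0 < Re u"
  shows "norm (a * exp (- u)) < 1"
  using assms by (simp add: norm_mult)

lemma one_minus_not_nonpos_Reals:
  fixes y :: complex assumes "norm y < 1"
  shows "1 - y \<notin> \<real>\<^sub>\<le>\<^sub>0"
  using assms complex_Re_le_cmod[of y] by (auto simp: complex_nonpos_Reals_iff)

lemma DERIV_dilog_exp:
  assumes a: "norm a = 1" and u: "0 < Re u"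
  shows "((\<lambda>u. dilog (a * exp (- u))) has_field_derivative Ln (1 - a * exp (- u))) (at u)"
proof -
  have nz: "a * exp (- u) \<noteq> 0" using a by auto
  show ?thesis
    by (rule DERIV_cong[OF DERIV_chain'[where g = dilog and f = "\<lambda>u. a * exp (- u)" and x = u and s = UNIV,
            OF _ DERIV_dilog[OF norm_unit_exp_less_1[OF a u] nz]]])
       (use nz in \<open>auto intro!: derivative_eq_intros\<close>)
qed

lemma DERIV_Ln_one_minus_exp:
  assumes a: "norm a = 1" and u: "0 < Re u"
  shows "((\<lambda>u. Ln (1 - a * exp (- u))) has_field_derivative a * exp (- u) / (1 - a * exp (- u))) (at u)"
  by (rule derivative_eq_intros refl one_minus_not_nonpos_Reals norm_unit_exp_less_1 assms)+
     (simp add: divide_inverse mult.commute)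

lemma DERIV_geometric_exp:
  assumes a: "norm a = 1" and u: "0 < Re u"
  shows "((\<lambda>u. a * exp (- u) / (1 - a * exp (- u))) has_field_derivative
           - (a * exp (- u)) / (1 - a * exp (- u)) ^ 2) (at u)"
proof -
  have "1 - a * exp (- u) \<noteq> 0" using norm_unit_exp_less_1[OF a u] by auto
  then show ?thesis
    by (auto intro!: derivative_eq_intros simp: field_simps power2_eq_square)
qed

lemma exp_minus_le_inverse_square:
  fixes r :: real assumes "0 \<le> r"
  shows "exp (- r) \<le> 4 / (1 + r)\<^sup>2"
proof -
  have "1 + r / 2 \<le> exp (r / 2)" by simp
  then have "(1 + r / 2)\<^sup>2 \<le> exp (r / 2) ^ 2" using assms by (intro power_mono) auto
  also have "\<dots> = exp r" by (simp add: exp_double[symmetric])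
  finally have "(1 + r)\<^sup>2 \<le> 4 * exp r" using assms by (simp add: power2_eq_square algebra_simps)
  then show ?thesis using assms by (simp add: exp_minus field_simps)
qed

lemma norm_one_minus_exp_ge:
  assumes "norm a = 1" "r \<le> Re u"
  shows "1 - exp (- r) \<le> norm (1 - a * exp (- u))"
proof -
  have "1 - norm (a * exp (- u)) \<le> norm (1 - a * exp (- u))"
    using norm_triangle_ineq2[of 1 "a * exp (- u)"] by simp
  moreover have "norm (a * exp (- u)) \<le> exp (- r)" using assms by (simp add: norm_mult)
  ultimately show ?thesis by linarith
qed

text \<open>Near 0 the value is close to 1 - a, which is nonzero. At distance \<delta> or more from
  0 the wedge forces Re u >= c \<delta>, so a exp (-u) stays at distance at least 1 - exp (-c
  \<delta>) from 1.\<close>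

lemma one_minus_exp_bounded_below:
  assumes a: "norm a = 1" "a \<noteq> 1" and c: "0 < c"
  obtains d where "0 < d" "\<And>u. u \<in> wedge c \<Longrightarrow> d \<le> norm (1 - a * exp (- u))"
proof -
  have "((\<lambda>u. norm (1 - a * exp (- u))) \<longlongrightarrow> norm (1 - a * exp (- 0))) (at 0)"
    by (intro tendsto_intros)
  moreover have "norm (1 - a) / 2 < norm (1 - a * exp (- 0))" using a by simp
  ultimately have "\<forall>\<^sub>F u in at 0. norm (1 - a) / 2 < norm (1 - a * exp (- u))"
    by (rule order_tendstoD)
  then obtain \<delta> where \<delta>: "0 < \<delta>" "\<And>u. u \<noteq> 0 \<Longrightarrow> norm u < \<delta> \<Longrightarrow> norm (1 - a) / 2 < norm (1 - a * exp (- u))"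
    unfolding eventually_at by (auto simp: dist_norm)
  define d where "d = min (norm (1 - a) / 2) (1 - exp (- (c * \<delta>)))"
  show ?thesis
  proof (rule that[of d])
    show "0 < d" using a c \<delta> by (simp add: d_def)
    show "d \<le> norm (1 - a * exp (- u))" if u: "u \<in> wedge c" for u
    proof (cases "u = 0 \<or> norm u < \<delta>")
      case True
      then show ?thesis using \<delta>(2)[of u] by (cases "u = 0") (auto simp: d_def min_le_iff_disj)
    next
      case False
      then have "c * \<delta> \<le> c * norm u" using c by (intro mult_left_mono) auto
      then have "c * \<delta> \<le> Re u" using u by (simp add: wedge_def)
      from norm_one_minus_exp_ge[OF a(1) this] show ?thesis by (simp add: d_def)
    qed
  qed
qed

lemma norm_second_deriv_le:
  assumes a: "norm a = 1" and u: "0 \<le> Re u" and d: "0 < d" "d \<le> norm (1 - a * exp (- u))"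
  shows "norm (- (a * exp (- u)) / (1 - a * exp (- u)) ^ 2) \<le> (4 / d\<^sup>2) / (1 + Re u)\<^sup>2"
proof -
  have "norm (- (a * exp (- u)) / (1 - a * exp (- u)) ^ 2) = exp (- Re u) / norm (1 - a * exp (- u)) ^ 2"
    using a by (simp add: norm_divide norm_mult norm_power)
  also have "\<dots> \<le> (4 / (1 + Re u)\<^sup>2) / d\<^sup>2"
    using d u by (intro frac_le exp_minus_le_inverse_square power_mono) auto
  finally show ?thesis by (simp add: mult.commute)
qed

lemma tendsto_dilog_exp_0:
  assumes a: "norm a = 1" and c: "0 \<le> c"
  shows "((\<lambda>u. dilog (a * exp (- u))) \<longlongrightarrow> dilog a) (at 0 within wedge c)"
proof -
  have "continuous_on (wedge c) (\<lambda>u. dilog (a * exp (- u)))"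
  proof (rule continuous_on_compose2[OF continuous_on_dilog])
    show "(\<lambda>u. a * exp (- u)) ` wedge c \<subseteq> cball 0 1"
    proof (clarsimp simp: norm_mult a)
      fix u assume "u \<in> wedge c"
      then have "c * norm u \<le> Re u" by (simp add: wedge_def)
      moreover have "0 \<le> c * norm u" using c by simp
      ultimately show "0 \<le> Re u" by linarith
    qed
  qed (intro continuous_intros)
  from this[unfolded continuous_on_def, rule_format, of 0]
  show ?thesis by simp
qed

lemma tendsto_exp_multiples_0:
  assumes "0 < Re w"
  shows "(\<lambda>N. a * exp (- (of_nat N * w))) \<longlonglongrightarrow> 0"
proof -
  have "norm (exp (- w)) < 1" using assms by simp
  then have "(\<lambda>N. a * exp (- w) ^ N) \<longlonglongrightarrow> a * 0"
    by (intro tendsto_mult tendsto_const LIMSEQ_power_zero)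
  then show ?thesis by (simp add: exp_of_nat_mult[symmetric])
qed

lemma tendsto_dilog_multiples:
  assumes "0 < Re w"
  shows "(\<lambda>N. dilog (a * exp (- (of_nat N * w)))) \<longlonglongrightarrow> 0"
proof -
  have "isCont dilog 0"
    using continuous_on_dilog by (rule continuous_on_interior) (simp add: interior_cball)
  from isCont_tendsto_compose[OF this tendsto_exp_multiples_0[OF assms]]
  show ?thesis by simp
qed

lemma tendsto_Ln_multiples:
  assumes "0 < Re w"
  shows "(\<lambda>N. Ln (1 - a * exp (- (of_nat N * w)))) \<longlonglongrightarrow> 0"
proof -
  have "(\<lambda>N. Ln (1 - a * exp (- (of_nat N * w)))) \<longlonglongrightarrow> Ln (1 - 0)"
    by (intro tendsto_Ln tendsto_diff tendsto_const tendsto_exp_multiples_0[OF assms]) auto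
  then show ?thesis by simp
qed

subsection \<open>The singular summand\<close>

lemma one_minus_exp_quotient_holomorphic:
  "(\<lambda>u::complex. if u = 0 then 1 else (1 - exp (- u)) / u) holomorphic_on UNIV"
proof -
  have "(\<lambda>u::complex. - exp (- u)) holomorphic_on UNIV" by (intro holomorphic_intros)
  from pole_lemma_open[OF this open_UNIV, of 0]
  have "(\<lambda>u::complex. if u = 0 then deriv (\<lambda>u. - exp (- u)) 0 else (- exp (- u) - - exp (- 0)) / (u - 0)) holomorphic_on UNIV" .
  moreover have "deriv (\<lambda>u::complex. - exp (- u)) 0 = 1"
    by (intro DERIV_imp_deriv) (auto intro!: derivative_eq_intros)
  ultimately show ?thesis by (simp add: if_distrib cong: if_cong)
qed

text \<open>The summand for a = 1 without its logarithmic singularity. Since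
  \<open>Ln 0 = 0\<close>, its value at 0 is 0, which is also its limit there, so no case
  distinction is required.\<close>

definition log_quot :: "complex \<Rightarrow> complex" where
  "log_quot u = Ln (1 - exp (- u)) - Ln u"

text \<open>An antiderivative of \<open>log_quot\<close>: the subtracted u Ln u - u is one for Ln u.
  It tends to 0 at 0, so the boundary value there is \<open>dilog 1\<close>.\<close>

definition dilog_quot :: "complex \<Rightarrow> complex" where
  "dilog_quot u = dilog (exp (- u)) - (u * Ln u - u)"

lemma log_quot_0 [simp]: "log_quot 0 = 0"
  by (simp add: log_quot_def)

lemma dilog_quot_0 [simp]: "dilog_quot 0 = dilog 1"
  by (simp add: dilog_quot_def)

text \<open>Both u and 1 - exp (-u) lie in the open right half-plane, so their arguments differ by
  less than pi and no multiple of 2 pi i intervenes.\<close>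

lemma log_quot_altdef:
  assumes "0 < Re u"
  shows "log_quot u = Ln ((1 - exp (- u)) / u)"
proof -
  define v where "v = 1 - exp (- u)"
  have "Re (exp (- u)) < 1"
    using complex_Re_le_cmod[of "exp (- u)"] assms by (smt (verit) exp_less_one_iff norm_exp_eq_Re uminus_complex.sel(1))
  then have v: "0 < Re v" by (simp add: v_def)
  have nz: "v \<noteq> 0" "u \<noteq> 0" using v assms by auto
  have "\<bar>Im (Ln v)\<bar> < pi / 2" "\<bar>Im (Ln u)\<bar> < pi / 2"
    using Re_Ln_pos_lt[OF nz(1)] Re_Ln_pos_lt[OF nz(2)] v assms by auto
  then have "Ln (v / u) = Ln v - Ln u"
    by (intro Ln_unique) (use nz in \<open>auto simp: exp_diff\<close>)
  then show ?thesis by (simp add: log_quot_def v_def)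
qed

lemma DERIV_log_quot:
  assumes "0 < Re u"
  shows "(log_quot has_field_derivative exp (- u) / (1 - exp (- u)) - 1 / u) (at u)"
  using DERIV_diff[OF DERIV_Ln_one_minus_exp[of 1 u] has_field_derivative_Ln[of u]] assms
  unfolding log_quot_def[abs_def] by (auto simp: complex_nonpos_Reals_iff divide_inverse)

lemma DERIV_log_quot_deriv:
  assumes "0 < Re u"
  shows "((\<lambda>u. exp (- u) / (1 - exp (- u)) - 1 / u) has_field_derivative
           1 / u ^ 2 - exp (- u) / (1 - exp (- u)) ^ 2) (at u)"
proof -
  have "u \<noteq> 0" using assms by auto
  then have "((\<lambda>u. 1 / u) has_field_derivative - (1 / u ^ 2)) (at u)"
    by (auto intro!: derivative_eq_intros simp: power2_eq_square)
  from DERIV_diff[OF DERIV_geometric_exp[of 1 u] this] assms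
  show ?thesis by simp
qed

lemma DERIV_dilog_quot:
  assumes "0 < Re u"
  shows "(dilog_quot has_field_derivative log_quot u) (at u)"
proof -
  have nz: "u \<noteq> 0" "u \<notin> \<real>\<^sub>\<le>\<^sub>0" using assms by (auto simp: complex_nonpos_Reals_iff)
  then have "((\<lambda>u. u * Ln u - u) has_field_derivative Ln u) (at u)"
    by (auto intro!: derivative_eq_intros)
  from DERIV_diff[OF DERIV_dilog_exp[of 1 u] this] assms
  show ?thesis unfolding dilog_quot_def[abs_def] log_quot_def by simp
qed

text \<open>Near \<open>0\<close> the function \<^const>\<open>log_quot\<close> agrees with the logarithm of the entire function
  \<open>(1 - exp (- u)) / u\<close>, which takes the value \<open>1\<close> at \<open>0\<close>.\<close>

lemma log_quot_near_0:
  obtains \<delta> M where "0 < \<delta>"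
    "\<And>u. 0 < Re u \<Longrightarrow> norm u < \<delta> \<Longrightarrow> norm (1 / u ^ 2 - exp (- u) / (1 - exp (- u)) ^ 2) \<le> M"
    "(log_quot \<longlongrightarrow> 0) (at 0 within {u. 0 < Re u})"
proof -
  define s where "s u = (if u = 0 then 1 else (1 - exp (- u)) / u)" for u :: complex
  have s: "s holomorphic_on UNIV" unfolding s_def by (rule one_minus_exp_quotient_holomorphic)
  have "continuous_on UNIV s" using s by (rule holomorphic_on_imp_continuous_on)
  then have "(s \<longlongrightarrow> s 0) (nhds 0)" by (simp add: continuous_on_eq_continuous_at isCont_def tendsto_at_iff_tendsto_nhds)
  then have "\<forall>\<^sub>F u in nhds 0. s u \<in> ball 1 1"
    by (rule topological_tendstoD) (auto simp: s_def)
  then obtain r where r: "0 < r" "\<And>u::complex. norm u < r \<Longrightarrow> s u \<in> ball 1 1"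
    unfolding eventually_nhds_metric by (auto simp: dist_norm)
  define g where "g u = Ln (s u)" for u
  have g: "g holomorphic_on ball 0 r"
    unfolding g_def
  proof (rule holomorphic_on_Ln'[OF _ holomorphic_on_subset[OF s]])
    fix u :: complex assume "u \<in> ball 0 r"
    then have "norm (1 - s u) < 1" using r(2)[of u] by (simp add: dist_norm)
    from one_minus_not_nonpos_Reals[OF this] show "s u \<notin> \<real>\<^sub>\<le>\<^sub>0" by simp
  qed auto
  define g2 where "g2 = deriv (deriv g)"
  have "g2 holomorphic_on ball 0 r"
    unfolding g2_def by (intro holomorphic_deriv g open_ball)
  \<comment> \<open>The formula for the second derivative is a difference of two terms that blow up
    at 0. Their cancellation is read off from holomorphy of \<open>g\<close> at 0, and the bound is
    compactness of a smaller disc.\<close>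
  then have "continuous_on (cball 0 (r/2)) g2"
    using r by (intro holomorphic_on_imp_continuous_on) (auto intro: holomorphic_on_subset)
  then have "compact (g2 ` cball 0 (r/2))" by (rule compact_continuous_image) simp
  then obtain M where M: "\<And>u. u \<in> cball 0 (r/2) \<Longrightarrow> norm (g2 u) \<le> M"
    by (meson compact_imp_bounded bounded_iff imageI)
  define V where "V = ball 0 r \<inter> {u. 0 < Re u}"
  have V: "open V" unfolding V_def by (intro open_Int open_ball open_halfspace_Re_gt)
  have gl: "g u = log_quot u" if "u \<in> V" for u
    using that by (auto simp: g_def s_def V_def log_quot_altdef)
  have d1: "deriv g u = exp (- u) / (1 - exp (- u)) - 1 / u" if "u \<in> V" for u
    by (rule DERIV_imp_deriv, rule has_field_derivative_transform_within_open[OF DERIV_log_quot V that])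
       (use that gl in \<open>auto simp: V_def\<close>)
  have d2: "g2 u = 1 / u ^ 2 - exp (- u) / (1 - exp (- u)) ^ 2" if "u \<in> V" for u
    unfolding g2_def
    by (rule DERIV_imp_deriv, rule has_field_derivative_transform_within_open[OF DERIV_log_quot_deriv V that])
       (use that d1 in \<open>auto simp: V_def\<close>)
  have "isCont g 0"
    using holomorphic_on_imp_continuous_on[OF g] r by (simp add: continuous_on_eq_continuous_at)
  then have "(g \<longlongrightarrow> 0) (at 0)" by (simp add: isCont_def g_def s_def)
  then have "(g \<longlongrightarrow> 0) (at 0 within {u. 0 < Re u})" by (rule tendsto_within_subset) simp
  moreover have "\<forall>\<^sub>F u in at 0 within {u. 0 < Re u}. g u = log_quot u"
    unfolding eventually_at by (intro exI[of _ r]) (use r gl in \<open>auto simp: V_def\<close>)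
  ultimately have "(log_quot \<longlongrightarrow> 0) (at 0 within {u. 0 < Re u})"
    by (rule Lim_transform_eventually)
  moreover have "norm (1 / u ^ 2 - exp (- u) / (1 - exp (- u)) ^ 2) \<le> M" if "0 < Re u" "norm u < r/2" for u
    using that r M[of u] d2[of u] by (simp add: V_def)
  ultimately show ?thesis using r(1) that[of "r/2" M] by simp
qed

text \<open>Far from 0 the two terms are estimated separately. The term 1 / u^2 decays no faster
  than an inverse square, which is why the summation error is formulated with inverse-square rather
  than exponential decay.\<close>

lemma log_quot_second_deriv_le:
  assumes c: "0 < c"
  obtains C where "0 \<le> C" "\<And>u. u \<in> wedge c \<Longrightarrow> u \<noteq> 0 \<Longrightarrow>
    norm (1 / u ^ 2 - exp (- u) / (1 - exp (- u)) ^ 2) \<le> C / (1 + Re u)\<^sup>2"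
proof -
  obtain \<delta> M where \<delta>: "0 < \<delta>"
    and M: "\<And>u. 0 < Re u \<Longrightarrow> norm u < \<delta> \<Longrightarrow> norm (1 / u ^ 2 - exp (- u) / (1 - exp (- u)) ^ 2) \<le> M"
    using log_quot_near_0 by metis
  define d where "d = 1 - exp (- (c * \<delta>))"
  have d: "0 < d" using c \<delta> by (simp add: d_def)
  \<comment> \<open>The first entry serves |u| < \<delta>, where 1 + Re u < 1 + \<delta>. The second
    serves |u| >= \<delta>, where 1 + Re u <= (1 / \<delta> + 1) |u|.\<close>
  define C where "C = max (\<bar>M\<bar> * (1 + \<delta>)\<^sup>2) ((1 / \<delta> + 1)\<^sup>2 + 4 / d\<^sup>2)"
  show ?thesis
  proof (rule that[of C])
    show "0 \<le> C" by (simp add: C_def le_max_iff_disj)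
    show "norm (1 / u ^ 2 - exp (- u) / (1 - exp (- u)) ^ 2) \<le> C / (1 + Re u)\<^sup>2"
      if u: "u \<in> wedge c" "u \<noteq> 0" for u
    proof (cases "norm u < \<delta>")
      case True
      have R: "0 < Re u" using wedge_Re_pos[OF c u] .
      have "Re u < \<delta>" using True complex_Re_le_cmod[of u] by linarith
      then have "(1 + Re u)\<^sup>2 \<le> (1 + \<delta>)\<^sup>2" using R by (intro power_mono) auto
      then have "M * (1 + Re u)\<^sup>2 \<le> \<bar>M\<bar> * (1 + \<delta>)\<^sup>2" by (intro mult_mono) auto
      also have "\<dots> \<le> C" by (simp add: C_def)
      finally have "M \<le> C / (1 + Re u)\<^sup>2" using R by (simp add: pos_le_divide_eq)
      with M[OF R True] show ?thesis by linarith
    next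
      case False
      have R: "0 < Re u" using wedge_Re_pos[OF c u] .
      have "c * \<delta> \<le> c * norm u" using c False by (intro mult_left_mono) auto
      then have "c * \<delta> \<le> Re u" using u by (simp add: wedge_def)
      then have "d \<le> norm (1 - 1 * exp (- u))"
        unfolding d_def by (intro norm_one_minus_exp_ge) auto
      from norm_second_deriv_le[OF _ _ d this] R
      have 1: "norm (exp (- u) / (1 - exp (- u)) ^ 2) \<le> (4 / d\<^sup>2) / (1 + Re u)\<^sup>2"
        by simp
      have "1 \<le> 1 / \<delta> * norm u" using False \<delta> by (simp add: field_simps)
      then have "1 + Re u \<le> (1 / \<delta> + 1) * norm u"
        using complex_Re_le_cmod[of u] by (simp add: algebra_simps)
      then have "(1 + Re u)\<^sup>2 \<le> (1 / \<delta> + 1)\<^sup>2 * norm u ^ 2"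
        unfolding power_mult_distrib[symmetric] using R by (intro power_mono) auto
      then have 2: "norm (1 / u ^ 2) \<le> (1 / \<delta> + 1)\<^sup>2 / (1 + Re u)\<^sup>2"
        using R u by (simp add: norm_divide norm_power pos_le_divide_eq pos_divide_le_eq)
      have "norm (1 / u ^ 2 - exp (- u) / (1 - exp (- u)) ^ 2) \<le>
         (1 / \<delta> + 1)\<^sup>2 / (1 + Re u)\<^sup>2 + (4 / d\<^sup>2) / (1 + Re u)\<^sup>2"
        using norm_triangle_ineq4 1 2 add_mono order_trans by blast
      also have "\<dots> = ((1 / \<delta> + 1)\<^sup>2 + 4 / d\<^sup>2) / (1 + Re u)\<^sup>2" by (simp add: add_divide_distrib)
      also have "\<dots> \<le> C / (1 + Re u)\<^sup>2"
        by (intro divide_right_mono) (auto simp: C_def)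
      finally show ?thesis .
    qed
  qed
qed

lemma wedge_minus_0_subset: "0 < c \<Longrightarrow> wedge c - {0} \<subseteq> {u. 0 < Re u}"
  using wedge_Re_pos by auto

lemma at_0_within_wedge_le:
  assumes "0 < c"
  shows "at 0 within wedge c \<le> at 0 within {u. 0 < Re u}"
proof -
  have "at 0 within wedge c = at 0 within (wedge c - {0})" by (simp add: at_within_def)
  also have "\<dots> \<le> at 0 within {u. 0 < Re u}" by (rule at_le[OF wedge_minus_0_subset[OF assms]])
  finally show ?thesis .
qed

lemma tendsto_log_quot_0:
  assumes "0 < c"
  shows "(log_quot \<longlongrightarrow> log_quot 0) (at 0 within wedge c)"
  using log_quot_near_0 tendsto_mono[OF at_0_within_wedge_le[OF assms]] by (metis log_quot_0)

lemma tendsto_times_Ln_0: "((\<lambda>u. u * Ln u) \<longlongrightarrow> 0) (at 0)"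
proof -
  have "((\<lambda>r::real. r * (\<bar>ln r\<bar> + pi)) \<longlongrightarrow> 0) (at_right 0)" by real_asymp
  moreover have "filterlim (norm :: complex \<Rightarrow> real) (at_right 0) (at 0)"
    by (auto simp: filterlim_at eventually_at_filter intro!: tendsto_norm_zero tendsto_ident_at)
  ultimately have lim: "((\<lambda>u::complex. norm u * (\<bar>ln (norm u)\<bar> + pi)) \<longlongrightarrow> 0) (at 0)"
    by (rule filterlim_compose)
  have le: "norm (u * Ln u) \<le> norm u * (\<bar>ln (norm u)\<bar> + pi)" if "u \<noteq> 0" for u
  proof -
    have "norm (Ln u) \<le> \<bar>Re (Ln u)\<bar> + \<bar>Im (Ln u)\<bar>" by (rule cmod_le)
    also have "\<dots> \<le> \<bar>ln (norm u)\<bar> + pi"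
      using that Im_Ln_le_pi[of u] mpi_less_Im_Ln[of u] by simp
    finally show ?thesis unfolding norm_mult by (intro mult_left_mono) auto
  qed
  have "\<forall>\<^sub>F u in at 0. norm (u * Ln u) \<le> norm u * (\<bar>ln (norm u)\<bar> + pi)"
    using le by (simp only: eventually_at_filter) (blast intro: always_eventually)
  from Lim_null_comparison[OF this lim] show ?thesis .
qed

lemma tendsto_dilog_quot_0:
  assumes "0 < c"
  shows "(dilog_quot \<longlongrightarrow> dilog_quot 0) (at 0 within wedge c)"
proof -
  have "((\<lambda>u. dilog (1 * exp (- u)) - (u * Ln u - u)) \<longlongrightarrow> dilog 1 - (0 - 0)) (at 0 within wedge c)"
    using assms
    by (intro tendsto_diff tendsto_dilog_exp_0 tendsto_ident_at
          tendsto_within_subset[OF tendsto_times_Ln_0]) auto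
  then show ?thesis unfolding dilog_quot_def[abs_def] by simp
qed

subsection \<open>Infinite products and residue classes\<close>

text \<open>With q = exp (-w) this is the q-Pochhammer symbol (a q^x; q) of infinite length.\<close>

definition qprod :: "complex \<Rightarrow> real \<Rightarrow> complex \<Rightarrow> complex" where
  "qprod a x w = (\<Prod>m. 1 - a * exp (- (of_real (real m + x) * w)))"

lemma convergent_prod_one_minus_exp:
  fixes a :: "nat \<Rightarrow> complex"
  assumes a: "\<And>m. norm (a m) \<le> 1" and w: "0 < Re w"
  shows "convergent_prod (\<lambda>m. 1 - a m * exp (- (of_real (real m + x) * w)))"
proof (rule abs_convergent_prod_imp_convergent_prod)
  have "summable (\<lambda>m. exp (- (x * Re w)) * exp (- Re w) ^ m)"
    using w by (intro summable_mult summable_geometric) auto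
  moreover have "norm (norm (1 - a m * exp (- (of_real (real m + x) * w)) - 1)) \<le>
      exp (- (x * Re w)) * exp (- Re w) ^ m" for m
  proof -
    have "norm (a m) * exp (- ((real m + x) * Re w)) \<le> exp (- ((real m + x) * Re w))"
      using a[of m] by (simp add: mult_left_le_one_le)
    also have "\<dots> = exp (- (x * Re w)) * exp (- Re w) ^ m"
      by (simp add: exp_add[symmetric] exp_of_nat_mult[symmetric] algebra_simps)
    finally show ?thesis by (simp add: norm_mult)
  qed
  ultimately have "summable (\<lambda>m. norm (1 - a m * exp (- (of_real (real m + x) * w)) - 1))"
    by (rule summable_comparison_test'[of _ 0])
  then show "abs_convergent_prod (\<lambda>m. 1 - a m * exp (- (of_real (real m + x) * w)))"
    unfolding abs_convergent_prod_conv_summable .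
qed

lemma LIMSEQ_prodinf_lessThan:
  fixes f :: "nat \<Rightarrow> complex"
  assumes "convergent_prod f"
  shows "(\<lambda>N. \<Prod>m<N. f m) \<longlonglongrightarrow> prodinf f"
  using convergent_prod_LIMSEQ[OF assms] by (simp add: LIMSEQ_lessThan_iff_atMost)

lemma LIMSEQ_qprod:
  assumes "norm a = 1" "0 < Re w"
  shows "(\<lambda>N. \<Prod>m<N. 1 - a * exp (- (of_real (real m + x) * w))) \<longlonglongrightarrow> qprod a x w"
  unfolding qprod_def
  using assms by (intro LIMSEQ_prodinf_lessThan convergent_prod_one_minus_exp) auto

lemma prod_lessThan_mult:
  fixes f :: "nat \<Rightarrow> 'a :: comm_monoid_mult"
  shows "(\<Prod>n<K * M. f n) = (\<Prod>r<K. \<Prod>m<M. f (m * K + r))"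
proof -
  have "(\<Prod>n<K * M. f n) = (\<Prod>m<M. prod f {m * K..<m * K + K})"
    by (simp add: prod.nat_group mult.commute)
  also have "\<dots> = (\<Prod>m<M. \<Prod>r<K. f (m * K + r))"
  proof (rule prod.cong[OF refl])
    fix m
    show "prod f {m * K..<m * K + K} = (\<Prod>r<K. f (m * K + r))"
      using prod.shift_bounds_nat_ivl[of f 0 "m * K" K] by (simp add: atLeast0LessThan add.commute)
  qed
  finally show ?thesis by (subst prod.swap)
qed

lemma prodinf_residue_classes:
  fixes a :: "nat \<Rightarrow> complex"
  assumes K: "0 < K" and a: "\<And>n. norm (a n) = 1" and per: "\<And>n. a (n + K) = a n"
    and v: "0 < Re v"
  shows "(\<Prod>n. 1 - a n * exp (- (of_nat (Suc n) * v))) =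
         (\<Prod>r<K. qprod (a r) (real (Suc r) / real K) (of_nat K * v))"
proof -
  define f where "f n = 1 - a n * exp (- (of_nat (Suc n) * v))" for n
  have per': "a (m * K + r) = a r" for m r
  proof (induction m)
    case (Suc m)
    then show ?case using per[of "m * K + r"] by (simp add: add_ac)
  qed simp
  have "convergent_prod f"
    using convergent_prod_one_minus_exp[of a v 1] a v by (simp add: f_def[abs_def] add.commute)
  then have "(\<lambda>N. \<Prod>n<N. f n) \<longlonglongrightarrow> prodinf f" by (rule LIMSEQ_prodinf_lessThan)
  moreover have "filterlim (\<lambda>M. K * M) sequentially sequentially"
    using K by (simp add: filterlim_subseq strict_mono_def)
  ultimately have 1: "(\<lambda>M. \<Prod>n<K * M. f n) \<longlonglongrightarrow> prodinf f" by (rule filterlim_compose)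
  \<comment> \<open>Indices start at 0 while exponents start at 1, so residue r gets the shift (r +
    1) / K, and the step length becomes K v.\<close>
  have f_eq: "f (m * K + r) = 1 - a r * exp (- (of_real (real m + real (Suc r) / real K) * (of_nat K * v)))" for m r
  proof -
    have "complex_of_nat (Suc (m * K + r)) * v = of_real (real m + real (Suc r) / real K) * (of_nat K * v)"
      using K by (simp add: field_simps)
    then show ?thesis by (simp only: f_def per')
  qed
  have "(\<lambda>M. \<Prod>r<K. \<Prod>m<M. f (m * K + r)) \<longlonglongrightarrow>
      (\<Prod>r<K. qprod (a r) (real (Suc r) / real K) (of_nat K * v))"
    unfolding f_eq using a K v by (intro tendsto_prod LIMSEQ_qprod) auto
  then have "(\<lambda>M. \<Prod>n<K * M. f n) \<longlonglongrightarrow> (\<Prod>r<K. qprod (a r) (real (Suc r) / real K) (of_nat K * v))"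
    unfolding prod_lessThan_mult .
  from LIMSEQ_unique[OF 1 this] show ?thesis by (simp add: f_def[abs_def])
qed

section \<open>Multiplicative asymptotics with error exp (O(|z|))\<close>

text \<open>The error is kept in the exponent, since in products the exponents simply add and no
  quotient f / g has to be formed. The form 1 + O(|z|) is recovered only at the end.\<close>

definition exp_close :: "real \<Rightarrow> (complex \<Rightarrow> complex) \<Rightarrow> (complex \<Rightarrow> complex) \<Rightarrow> bool" where
  "exp_close c f g \<longleftrightarrow> (\<exists>e. e \<in> O[at 0 within wedge c](\<lambda>z. of_real (norm z)) \<and>
     (\<forall>\<^sub>F w in at 0 within wedge c. f w = g w * exp (e w :: complex)))"

lemma exp_closeI:
  fixes e f g :: "complex \<Rightarrow> complex"
  assumes "\<And>w. w \<in> wedge c \<Longrightarrow> w \<noteq> 0 \<Longrightarrow> norm w \<le> 1 \<Longrightarrow> f w = g w * exp (e w)"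
    and "\<And>w. w \<in> wedge c \<Longrightarrow> w \<noteq> 0 \<Longrightarrow> norm w \<le> 1 \<Longrightarrow> norm (e w) \<le> C * norm w"
  shows "exp_close c f g"
proof -
  have ev: "\<forall>\<^sub>F w in at 0 within wedge c. w \<in> wedge c \<and> w \<noteq> 0 \<and> norm w \<le> 1"
    unfolding eventually_at by (rule exI[of _ 1]) auto
  have "e \<in> O[at 0 within wedge c](\<lambda>z. of_real (norm z))"
    by (rule bigoI[of _ C]) (use ev assms in \<open>auto elim!: eventually_mono\<close>)
  moreover have "\<forall>\<^sub>F w in at 0 within wedge c. f w = g w * exp (e w)"
    using ev assms by (auto elim!: eventually_mono)
  ultimately show ?thesis unfolding exp_close_def by blast
qed

lemma exp_close_mult:
  assumes "exp_close c f g" "exp_close c f' g'"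
  shows "exp_close c (\<lambda>w. f w * f' w) (\<lambda>w. g w * g' w)"
proof -
  obtain e e' where e: "e \<in> O[at 0 within wedge c](\<lambda>z. of_real (norm z))"
     "e' \<in> O[at 0 within wedge c](\<lambda>z. of_real (norm z))"
    "\<forall>\<^sub>F w in at 0 within wedge c. f w = g w * exp (e w)"
    "\<forall>\<^sub>F w in at 0 within wedge c. f' w = g' w * exp (e' w)"
    using assms unfolding exp_close_def by blast
  have "\<forall>\<^sub>F w in at 0 within wedge c. f w * f' w = g w * g' w * exp (e w + e' w)"
    using e(3,4) by eventually_elim (simp add: exp_add)
  with sum_in_bigo(1)[OF e(1,2)] show ?thesis unfolding exp_close_def by blast
qed

lemma exp_close_refl: "exp_close c f f"
  unfolding exp_close_def by (rule exI[of _ "\<lambda>_. 0"]) auto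

lemma exp_close_prod:
  assumes "\<And>i. i \<in> A \<Longrightarrow> exp_close c (f i) (g i)"
  shows "exp_close c (\<lambda>w. \<Prod>i\<in>A. f i w) (\<lambda>w. \<Prod>i\<in>A. g i w)"
  using assms
  by (induction A rule: infinite_finite_induct) (auto intro: exp_close_mult exp_close_refl)

lemma exp_close_cong:
  assumes "exp_close c f g"
    and "\<And>w. w \<in> wedge c \<Longrightarrow> w \<noteq> 0 \<Longrightarrow> f w = f' w" "\<And>w. w \<in> wedge c \<Longrightarrow> w \<noteq> 0 \<Longrightarrow> g w = g' w"
  shows "exp_close c f' g'"
proof -
  have ev: "\<forall>\<^sub>F w in at 0 within wedge c. w \<in> wedge c \<and> w \<noteq> 0"
    by (auto simp: eventually_at_filter)
  obtain e where e: "e \<in> O[at 0 within wedge c](\<lambda>z. of_real (norm z))"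
    "\<forall>\<^sub>F w in at 0 within wedge c. f w = g w * exp (e w)"
    using assms unfolding exp_close_def by blast
  from e(2) ev have "\<forall>\<^sub>F w in at 0 within wedge c. f' w = g' w * exp (e w)"
    by eventually_elim (use assms in auto)
  with e(1) show ?thesis unfolding exp_close_def by blast
qed

lemma filterlim_scale_wedge:
  assumes "0 < r"
  shows "filterlim (\<lambda>w. of_real r * w) (at 0 within wedge c) (at 0 within wedge c)"
proof -
  have "((\<lambda>w. of_real r * w) \<longlongrightarrow> of_real r * 0) (at 0 within wedge c)"
    by (intro tendsto_intros)
  then show ?thesis using assms
    by (auto simp: filterlim_at eventually_at_filter intro!: wedge_scale always_eventually)
qed

lemma exp_close_scale:
  assumes "exp_close c f g" "0 < r"
  shows "exp_close c (\<lambda>w. f (of_real r * w)) (\<lambda>w. g (of_real r * w))"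
proof -
  obtain e where e: "e \<in> O[at 0 within wedge c](\<lambda>z. of_real (norm z))"
    "\<forall>\<^sub>F w in at 0 within wedge c. f w = g w * exp (e w)"
    using assms unfolding exp_close_def by blast
  note lim = filterlim_scale_wedge[OF assms(2), of c]
  have "(\<lambda>w. e (of_real r * w)) \<in> O[at 0 within wedge c](\<lambda>w. of_real (norm (of_real r * w)))"
    by (rule landau_o.big.compose[OF e(1) lim])
  also have "(\<lambda>w. of_real (norm (of_real r * w))) \<in> O[at 0 within wedge c](\<lambda>w. of_real (norm w))"
    by (rule bigoI[of _ r]) (use assms in \<open>auto simp: norm_mult\<close>)
  finally have 1: "(\<lambda>w. e (of_real r * w)) \<in> O[at 0 within wedge c](\<lambda>w. of_real (norm w))" .
  have "\<forall>\<^sub>F w in at 0 within wedge c. f (of_real r * w) = g (of_real r * w) * exp (e (of_real r * w))"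
    using eventually_compose_filterlim[OF e(2) lim] .
  with 1 show ?thesis unfolding exp_close_def by blast
qed

lemma bigo_norm_tendsto_0:
  assumes "e \<in> O[at 0 within S](\<lambda>z :: complex. of_real (norm z) :: complex)"
  shows "((e :: complex \<Rightarrow> complex) \<longlongrightarrow> 0) (at 0 within S)"
proof -
  have "((\<lambda>z::complex. of_real (norm z) :: complex) \<longlongrightarrow> of_real (norm (0::complex))) (at 0 within S)"
    by (intro tendsto_intros)
  then have "(\<lambda>z::complex. of_real (norm z) :: complex) \<in> o[at 0 within S](\<lambda>_. 1)"
    by (intro smalloI_tendsto) auto
  with assms have "e \<in> o[at 0 within S](\<lambda>_. 1)" by (rule landau_o.big_small_trans)
  from smalloD_tendsto[OF this] show ?thesis by simp
qed

text \<open>Once |e| < 1, |exp e - 1| <= exp 1 * |e|; so E = exp e - 1 inherits the bound of e, and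
  passing to a subset S only refines the filter.\<close>

lemma exp_close_imp_bigo:
  assumes "exp_close c f g" "S \<subseteq> wedge c"
  shows "\<exists>E. E \<in> O[at 0 within S](\<lambda>z. of_real (norm z)) \<and>
     (\<forall>\<^sub>F w in at 0 within S. f w = g w * (1 + E w :: complex))"
proof -
  obtain e where e: "e \<in> O[at 0 within wedge c](\<lambda>z. of_real (norm z))"
    "\<forall>\<^sub>F w in at 0 within wedge c. f w = g w * exp (e w)"
    using assms unfolding exp_close_def by blast
  have le: "at 0 within S \<le> at 0 within wedge c" using assms(2) by (rule at_le)
  have e1: "e \<in> O[at 0 within S](\<lambda>z. of_real (norm z))"
    using e(1) le by (rule landau_o.big.filter_mono[rotated])
  have e2: "\<forall>\<^sub>F w in at 0 within S. f w = g w * exp (e w)"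
    using e(2) le by (rule filter_leD[rotated])
  have "\<forall>\<^sub>F w in at 0 within S. norm (e w) < 1"
    using tendsto_norm_zero[OF bigo_norm_tendsto_0[OF e1]] by (rule order_tendstoD) simp
  then have "(\<lambda>w. exp (e w) - 1) \<in> O[at 0 within S](e)"
  proof (intro bigoI[of _ "exp 1"], eventually_elim)
    case (elim w)
    have "norm (exp (e w) - 1) \<le> exp \<bar>Re (e w)\<bar> * norm (e w)"
      using Taylor_exp[of "e w" 0] by simp
    also have "\<dots> \<le> exp 1 * norm (e w)"
      using elim abs_Re_le_cmod[of "e w"] by (intro mult_right_mono) auto
    finally show ?case .
  qed
  then have "(\<lambda>w. exp (e w) - 1) \<in> O[at 0 within S](\<lambda>z. of_real (norm z))"
    using e1 by (rule landau_o.big_trans)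
  with e2 show ?thesis by (intro exI[of _ "\<lambda>w. exp (e w) - 1"]) auto
qed

subsection \<open>Asymptotics of a single residue class\<close>

lemma qprod_regular:
  assumes a: "norm a = 1" "a \<noteq> 1" and x: "0 < x" "x \<le> 1" and c: "0 < c"
  shows "exp_close c (qprod a x)
     (\<lambda>w. exp (- dilog a / w) * exp (of_real (1/2 - x) * Ln (1 - a)))"
proof -
  define F where "F u = dilog (a * exp (- u))" for u
  define f where "f u = Ln (1 - a * exp (- u))" for u
  define e where "e w = suminf (em_error F f x w)" for w
  obtain d where d: "0 < d" "\<And>u. u \<in> wedge c \<Longrightarrow> d \<le> norm (1 - a * exp (- u))"
    using one_minus_exp_bounded_below[OF a c] by blast
  have F0: "(F \<longlongrightarrow> F 0) (at 0 within wedge c)"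
    using tendsto_dilog_exp_0[of a c] a c by (simp add: F_def[abs_def])
  \<comment> \<open>On the unit circle 1 - a is a nonpositive real only for a = 1, so Ln is
    continuous at 1 - a.\<close>
  have "a \<noteq> 1 \<Longrightarrow> 1 - a \<notin> \<real>\<^sub>\<le>\<^sub>0"
    using a complex_Re_le_cmod[of a] cmod_eq_Re[of a] abs_Re_le_cmod[of a]
    by (auto simp: complex_nonpos_Reals_iff complex_eq_iff cmod_def)
  then have "((\<lambda>u. Ln (1 - a * exp (- u))) \<longlongrightarrow> Ln (1 - a * exp (- 0))) (at 0 within wedge c)"
    using a by (intro tendsto_intros) auto
  then have f0: "(f \<longlongrightarrow> f 0) (at 0 within wedge c)" by (simp add: f_def[abs_def])
  have C0: "0 \<le> 4 / d\<^sup>2" by simp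
  show ?thesis
  proof (rule exp_closeI[where e = e and C = "4 * (4 / d\<^sup>2) / c"])
    fix w assume w: "w \<in> wedge c" "w \<noteq> 0" "norm w \<le> 1"
    have Rw: "0 < Re w" using wedge_Re_pos[OF c w(1,2)] .
    have le: "norm (em_error F f x w m) \<le> 2 * (4 / d\<^sup>2) * norm w ^ 2 * (1 / (1 + real m * Re w)\<^sup>2)" for m
    proof (rule em_error_le[OF c _ _ _ _ F0 f0 C0 w(1,2) x])
      fix u assume u: "u \<in> wedge c" "u \<noteq> 0"
      have Ru: "0 < Re u" using wedge_Re_pos[OF c u] .
      show "(F has_field_derivative f u) (at u)"
        using DERIV_dilog_exp[OF a(1) Ru] by (simp add: F_def[abs_def] f_def)
      show "(f has_field_derivative a * exp (- u) / (1 - a * exp (- u))) (at u)"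
        using DERIV_Ln_one_minus_exp[OF a(1) Ru] by (simp add: f_def[abs_def])
      show "((\<lambda>u. a * exp (- u) / (1 - a * exp (- u))) has_field_derivative
           - (a * exp (- u)) / (1 - a * exp (- u)) ^ 2) (at u)"
        using DERIV_geometric_exp[OF a(1) Ru] .
      show "norm (- (a * exp (- u)) / (1 - a * exp (- u)) ^ 2) \<le> (4 / d\<^sup>2) / (1 + Re u)\<^sup>2"
        using norm_second_deriv_le[OF a(1) _ d(1) d(2)[OF u(1)]] Ru by simp
    qed
    note e = summable_em_error[OF c C0 w le]
    show "norm (e w) \<le> 4 * (4 / d\<^sup>2) / c * norm w" using e(2) by (simp add: e_def)
    \<comment> \<open>The boundary values at N w vanish in the limit. Those at 0 give the two main
      terms, - dilog a / w and (1/2 - x) Ln (1 - a).\<close>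
    have "(\<lambda>N. (F (of_nat N * w) - F 0) / w + of_real (x - 1/2) * (f (of_nat N * w) - f 0)
       + (\<Sum>m<N. em_error F f x w m)) \<longlonglongrightarrow> (0 - F 0) / w + of_real (x - 1/2) * (0 - f 0) + e w"
      unfolding F_def[of "of_nat _ * w"] f_def[of "of_nat _ * w"] e_def
      using w by (intro tendsto_intros tendsto_dilog_multiples tendsto_Ln_multiples Rw summable_LIMSEQ e(1))
    then have "(\<lambda>N. \<Sum>m<N. f (of_real (real m + x) * w)) \<longlonglongrightarrow>
        - dilog a / w + of_real (1/2 - x) * Ln (1 - a) + e w"
      unfolding sum_em_error[where F = F] by (simp add: F_def f_def algebra_simps)
    then have "(\<lambda>N. exp (\<Sum>m<N. f (of_real (real m + x) * w))) \<longlonglongrightarrow>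
        exp (- dilog a / w + of_real (1/2 - x) * Ln (1 - a) + e w)"
      by (rule tendsto_exp)
    moreover have "exp (\<Sum>m<N. f (of_real (real m + x) * w)) =
        (\<Prod>m<N. 1 - a * exp (- (of_real (real m + x) * w)))" for N
    proof -
      have "1 - a * exp (- (of_real (real m + x) * w)) \<noteq> 0" for m
        using norm_unit_exp_less_1[OF a(1), of "of_real (real m + x) * w"] x Rw
        by (auto simp: add_nonneg_pos)
      then show ?thesis by (simp add: exp_sum f_def)
    qed
    ultimately have "(\<lambda>N. \<Prod>m<N. 1 - a * exp (- (of_real (real m + x) * w))) \<longlonglongrightarrow>
        exp (- dilog a / w + of_real (1/2 - x) * Ln (1 - a) + e w)" by simp
    from LIMSEQ_unique[OF LIMSEQ_qprod[OF a(1) Rw] this]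
    show "qprod a x w = exp (- dilog a / w) * exp (of_real (1/2 - x) * Ln (1 - a)) * exp (e w)"
      by (simp only: exp_add)
  qed
qed

section \<open>Stirling constants and the case a = 1\<close>

text \<open>The quotient of x (x + 1) ... (x + N - 1) by N^(N + x - 1/2) exp (-N). Its limit turns
  out to be sqrt (2 pi) / Gamma x.\<close>

definition stirling_quot :: "real \<Rightarrow> nat \<Rightarrow> complex" where
  "stirling_quot x N = pochhammer (of_real x) N * exp (of_real (real N - (real N + x - 1/2) * ln (real N)))"

definition stirling_limit :: "real \<Rightarrow> complex" where
  "stirling_limit x = lim (stirling_quot x)"

text \<open>Factors are written as u exp (log_quot u), so the partial product is
  \<open>stirling_quot x N\<close> times exp (s + r N) with r N convergent. Read backwards,
  convergence of \<open>qprod\<close> yields a limit of the quotients. That limit cannot depend on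
  w, so equating its expressions for different w determines \<open>qprod 1 x w\<close> up to a
  constant and the factor exp (e w).\<close>

lemma LIMSEQ_stirling_quot_aux:
  assumes x: "0 < x" "x \<le> 1" and c: "0 < c" "c \<le> 1"
  obtains e C where
    "\<And>w. w \<in> wedge c \<Longrightarrow> w \<noteq> 0 \<Longrightarrow> norm w \<le> 1 \<Longrightarrow> norm (e w) \<le> C * norm w"
    "\<And>w. w \<in> wedge c \<Longrightarrow> w \<noteq> 0 \<Longrightarrow> norm w \<le> 1 \<Longrightarrow>
       stirling_quot x \<longlonglongrightarrow> qprod 1 x w * exp (of_real (x - 1/2) * Ln w + dilog 1 / w - e w)"
proof -
  obtain C where C: "0 \<le> C" "\<And>u. u \<in> wedge c \<Longrightarrow> u \<noteq> 0 \<Longrightarrow>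
      norm (1 / u ^ 2 - exp (- u) / (1 - exp (- u)) ^ 2) \<le> C / (1 + Re u)\<^sup>2"
    using log_quot_second_deriv_le[OF c(1)] by blast
  define e where "e w = suminf (em_error dilog_quot log_quot x w)" for w
  show ?thesis
  proof (rule that[of e "4 * C / c"])
    fix w assume w: "w \<in> wedge c" "w \<noteq> 0" "norm w \<le> 1"
    have Rw: "0 < Re w" using wedge_Re_pos[OF c(1) w(1,2)] .
    have le: "norm (em_error dilog_quot log_quot x w m) \<le> 2 * C * norm w ^ 2 * (1 / (1 + real m * Re w)\<^sup>2)" for m
      by (rule em_error_le[OF c(1) DERIV_dilog_quot DERIV_log_quot DERIV_log_quot_deriv C(2)
            tendsto_dilog_quot_0[OF c(1)] tendsto_log_quot_0[OF c(1)] C(1) w(1,2) x])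
         (use wedge_Re_pos[OF c(1)] in auto)
    note e = summable_em_error[OF c(1) C(1) w le]
    show "norm (e w) \<le> 4 * C / c * norm w" using e(2) by (simp add: e_def)
    define P where "P N = (\<Prod>m<N. 1 - 1 * exp (- (of_real (real m + x) * w)))" for N
    define r where "r N = dilog (1 * exp (- (of_nat N * w))) / w
        + of_real (x - 1/2) * Ln (1 - 1 * exp (- (of_nat N * w)))
        + (\<Sum>m<N. em_error dilog_quot log_quot x w m)" for N
    define s where "s = of_real (1/2 - x) * Ln w - dilog 1 / w"
    have P_eq: "P N = stirling_quot x N * exp (s + r N)" if N: "0 < N" for N
    proof -
      have "P N = (\<Prod>m<N. (of_real (real m + x) * w) * exp (log_quot (of_real (real m + x) * w)))"
        unfolding P_def
      proof (intro prod.cong refl)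
        fix m
        define u where "u = of_real (real m + x) * w"
        have "0 < Re u" using x Rw by (simp add: u_def add_nonneg_pos)
        then have "norm (exp (- u)) < 1" "u \<noteq> 0"
          using norm_unit_exp_less_1[of 1 u] by auto
        then have "exp (- u) \<noteq> 1" by (metis norm_one order_less_irrefl)
        with \<open>u \<noteq> 0\<close>
        have "1 - 1 * exp (- u) = u * exp (log_quot u)"
          by (simp add: log_quot_def exp_diff)
        then show "1 - 1 * exp (- (of_real (real m + x) * w)) =
           (of_real (real m + x) * w) * exp (log_quot (of_real (real m + x) * w))"
          unfolding u_def .
      qed
      also have "\<dots> = pochhammer (of_real x) N * w ^ N * exp (\<Sum>m<N. log_quot (of_real (real m + x) * w))"
        by (simp add: prod.distrib exp_sum pochhammer_prod atLeast0LessThan add.commute)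
      also have "w ^ N = exp (of_nat N * Ln w)" using w by (simp add: exp_of_nat_mult)
      \<comment> \<open>At u = N w the subtracted parts u Ln u - u and Ln u of the boundary values
        supply - N Ln w, which cancels w^N, and exactly the exponent in
        \<open>stirling_quot\<close>.\<close>
      also have "(\<Sum>m<N. log_quot (of_real (real m + x) * w)) = s + r N - of_nat N * Ln w
          + of_real (real N - (real N + x - 1/2) * ln (real N))"
      proof -
        have L: "Ln (of_nat N * w) = of_real (ln (real N)) + Ln w"
          using Ln_times_of_real[of "real N" w] N w by (simp add: Ln_of_real)
        define D E B where "D = dilog (exp (- (of_nat N * w)))" "E = Ln (1 - exp (- (of_nat N * w)))"
          "B = complex_of_real (ln (real N))"
        show ?thesis
          unfolding sum_em_error[where F = dilog_quot] dilog_quot_def[of "of_nat N * w"] log_quot_def[of "of_nat N * w"]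
            r_def s_def L D_E_B_def[symmetric]
          using w by (simp add: D_E_B_def[symmetric]) (simp add: field_simps)
      qed
      also have "p * exp L * exp (S - L + T) = p * exp T * exp S" for p L S T :: complex
        by (simp add: exp_add exp_diff)
      finally show ?thesis by (simp only: stirling_quot_def)
    qed
    have "r \<longlonglongrightarrow> 0 / w + of_real (x - 1/2) * 0 + e w"
      unfolding r_def e_def
      using w by (intro tendsto_intros tendsto_dilog_multiples tendsto_Ln_multiples Rw summable_LIMSEQ e(1))
    then have "r \<longlonglongrightarrow> e w" by simp
    moreover have "P \<longlonglongrightarrow> qprod 1 x w"
      using LIMSEQ_qprod[of 1 w x] Rw by (simp add: P_def[abs_def])
    ultimately have "(\<lambda>N. P N * exp (- (s + r N))) \<longlonglongrightarrow> qprod 1 x w * exp (- (s + e w))"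
      by (intro tendsto_intros)
    moreover have "\<forall>\<^sub>F N in sequentially. P N * exp (- (s + r N)) = stirling_quot x N"
      using eventually_gt_at_top[of 0]
      by eventually_elim (simp add: P_eq mult.assoc exp_add[symmetric])
    ultimately have "stirling_quot x \<longlonglongrightarrow> qprod 1 x w * exp (- (s + e w))"
      by (rule Lim_transform_eventually)
    moreover have "- (s + e w) = of_real (x - 1/2) * Ln w + dilog 1 / w - e w"
      by (simp add: s_def algebra_simps)
    ultimately show "stirling_quot x \<longlonglongrightarrow> qprod 1 x w * exp (of_real (x - 1/2) * Ln w + dilog 1 / w - e w)"
      by simp
  qed
qed

lemma one_in_wedge: "c \<le> 1 \<Longrightarrow> 1 \<in> wedge c"
  by (simp add: wedge_def)

lemma LIMSEQ_stirling_quot: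
  assumes "0 < x" "x \<le> 1"
  shows "stirling_quot x \<longlonglongrightarrow> stirling_limit x"
proof -
  obtain e :: "complex \<Rightarrow> complex" where
    "stirling_quot x \<longlonglongrightarrow> qprod 1 x 1 * exp (of_real (x - 1/2) * Ln 1 + dilog 1 / 1 - e 1)"
    using LIMSEQ_stirling_quot_aux[OF assms, of 1] one_in_wedge[of 1] by (metis norm_one order_refl zero_less_one zero_neq_one)
  then show ?thesis unfolding stirling_limit_def by (simp add: limI)
qed

lemma qprod_singular_aux:
  assumes x: "0 < x" "x \<le> 1" and c: "0 < c" "c \<le> 1"
  shows "exp_close c (qprod 1 x)
     (\<lambda>w. stirling_limit x * exp (of_real (1/2 - x) * Ln w) * exp (- dilog 1 / w))"
proof -
  obtain e C where e: "\<And>w. w \<in> wedge c \<Longrightarrow> w \<noteq> 0 \<Longrightarrow> norm w \<le> 1 \<Longrightarrow> norm (e w) \<le> C * norm w"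
    and lim: "\<And>w. w \<in> wedge c \<Longrightarrow> w \<noteq> 0 \<Longrightarrow> norm w \<le> 1 \<Longrightarrow>
       stirling_quot x \<longlonglongrightarrow> qprod 1 x w * exp (of_real (x - 1/2) * Ln w + dilog 1 / w - e w)"
    using LIMSEQ_stirling_quot_aux[OF x c] by blast
  show ?thesis
  proof (rule exp_closeI[OF _ e])
    fix w assume w: "w \<in> wedge c" "w \<noteq> 0" "norm w \<le> 1"
    have "stirling_limit x = qprod 1 x w * exp (of_real (x - 1/2) * Ln w + dilog 1 / w - e w)"
      using LIMSEQ_unique[OF LIMSEQ_stirling_quot[OF x] lim[OF w]] .
    then have "qprod 1 x w = stirling_limit x * exp (- (of_real (x - 1/2) * Ln w + dilog 1 / w - e w))"
      by (simp add: mult.assoc exp_add[symmetric])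
    also have "- (of_real (x - 1/2) * Ln w + dilog 1 / w - e w) =
        of_real (1/2 - x) * Ln w + - dilog 1 / w + e w"
      by (simp add: algebra_simps)
    finally show "qprod 1 x w = stirling_limit x * exp (of_real (1/2 - x) * Ln w) * exp (- dilog 1 / w) * exp (e w)"
      by (simp only: exp_add mult.assoc)
  qed
qed

text \<open>The quotients for x and for 1 differ by Gauss's sequence x (x + 1) ... (x + N) / (N!
  N^x), which tends to 1 / Gamma x. The correction N / (x + N) removes its one surplus
  factor.\<close>

lemma stirling_limit_eq:
  assumes x: "0 < x" "x \<le> 1"
  shows "stirling_limit x = stirling_limit 1 / Gamma (of_real x)"
proof -
  have nz: "complex_of_real x \<notin> \<int>\<^sub>\<le>\<^sub>0"
  proof
    assume "complex_of_real x \<in> \<int>\<^sub>\<le>\<^sub>0"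
    then obtain n where "complex_of_real x = of_int n" "n \<le> 0" by (rule nonpos_Ints_cases)
    then have "x = of_int n" by (metis of_real_of_int_eq of_real_eq_iff)
    with x \<open>n \<le> 0\<close> show False by simp
  qed
  have nzx: "complex_of_real x + of_nat N \<noteq> 0" for N
    using nz by (metis add_eq_0_iff2 minus_of_nat_in_nonpos_Ints)
  have eq: "stirling_quot x N = stirling_quot 1 N * rGamma_series (of_real x) N * (of_nat N / (of_real x + of_nat N))"
    if N: "0 < N" for N
  proof -
    have "exp (of_real (real N - (real N + x - 1/2) * ln (real N))) =
       exp (of_real (real N - (real N + 1 - 1/2) * ln (real N))) * (of_nat N :: complex) / exp (of_real x * of_real (ln (real N)))"
    proof -
      have "(of_nat N :: complex) = exp (of_real (ln (real N)))"
        using N by (simp add: exp_of_real)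
      then have "exp (of_real (real N - (real N + 1 - 1/2) * ln (real N))) * (of_nat N :: complex) / exp (of_real x * of_real (ln (real N)))
         = exp (of_real (real N - (real N + 1 - 1/2) * ln (real N)) + of_real (ln (real N)) - of_real x * of_real (ln (real N)))"
        by (simp add: exp_add exp_diff)
      also have "of_real (real N - (real N + 1 - 1/2) * ln (real N)) + of_real (ln (real N)) - of_real x * of_real (ln (real N))
         = (of_real (real N - (real N + x - 1/2) * ln (real N)) :: complex)"
        by (simp add: algebra_simps)
      finally show ?thesis by simp
    qed
    then show ?thesis
      using nzx[of N]
      by (simp add: stirling_quot_def rGamma_series_def pochhammer_Suc pochhammer_fact[symmetric])
  qed
  have "stirling_quot x \<longlonglongrightarrow> stirling_limit 1 * rGamma (of_real x) * 1"
  proof (rule Lim_transform_eventually)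
    have "(\<lambda>N. of_real (real N / (x + real N)) :: complex) \<longlonglongrightarrow> of_real 1"
      by (intro tendsto_of_real) real_asymp
    then have "(\<lambda>N. of_nat N / (of_real x + of_nat N) :: complex) \<longlonglongrightarrow> 1" by simp
    then show "(\<lambda>N. stirling_quot 1 N * rGamma_series (of_real x) N * (of_nat N / (of_real x + of_nat N)))
        \<longlonglongrightarrow> stirling_limit 1 * rGamma (of_real x) * 1"
      by (intro tendsto_mult LIMSEQ_stirling_quot rGamma_series_LIMSEQ) auto
    show "\<forall>\<^sub>F N in sequentially. stirling_quot 1 N * rGamma_series (of_real x) N * (of_nat N / (of_real x + of_nat N)) = stirling_quot x N"
      using eventually_gt_at_top[of 0] by eventually_elim (simp add: eq)
  qed
  from LIMSEQ_unique[OF LIMSEQ_stirling_quot[OF x] this] show ?thesis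
    by (simp add: Gamma_def divide_inverse)
qed

subsection \<open>Roots of unity and the Stirling constant\<close>

lemma at_0_within_wedge_nontrivial:
  assumes "c \<le> 1"
  shows "at 0 within wedge c \<noteq> bot"
proof -
  have "0 islimpt wedge c"
    unfolding islimpt_approachable
  proof (intro allI impI)
    fix r :: real assume "0 < r"
    then show "\<exists>u\<in>wedge c. u \<noteq> 0 \<and> dist u 0 < r"
      using wedge_scale[OF _ one_in_wedge[OF assms], of "r/2"]
      by (intro bexI[of _ "of_real (r/2)"]) (auto simp del: of_real_divide)
  qed
  then show ?thesis by (simp add: trivial_limit_within)
qed

text \<open>After cancelling g, \<alpha> exp (e w) and \<beta> exp (e' w) agree near 0 and tend to
  \<alpha> and \<beta>. Limits are unique because c <= 1 puts the positive axis into the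
  wedge.\<close>

lemma exp_close_const_unique:
  assumes f: "exp_close c f (\<lambda>w. \<alpha> * g w)" "exp_close c f (\<lambda>w. \<beta> * g w)"
    and g: "\<And>w. w \<in> wedge c \<Longrightarrow> w \<noteq> 0 \<Longrightarrow> g w \<noteq> 0" and c: "c \<le> 1"
  shows "\<alpha> = \<beta>"
proof -
  let ?F = "at 0 within wedge c"
  obtain e e' where e: "e \<in> O[?F](\<lambda>z. of_real (norm z))" "e' \<in> O[?F](\<lambda>z. of_real (norm z))"
    "\<forall>\<^sub>F w in ?F. f w = \<alpha> * g w * exp (e w)" "\<forall>\<^sub>F w in ?F. f w = \<beta> * g w * exp (e' w)"
    using f unfolding exp_close_def by blast
  have ev: "\<forall>\<^sub>F w in ?F. w \<in> wedge c \<and> w \<noteq> 0" by (auto simp: eventually_at_filter)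
  have 1: "((\<lambda>w. \<alpha> * exp (e w)) \<longlongrightarrow> \<alpha> * exp 0) ?F" "((\<lambda>w. \<beta> * exp (e' w)) \<longlongrightarrow> \<beta> * exp 0) ?F"
    by (intro tendsto_intros bigo_norm_tendsto_0 e)+
  have "\<forall>\<^sub>F w in ?F. \<alpha> * exp (e w) = \<beta> * exp (e' w)"
    using e(3,4) ev by eventually_elim (use g in auto)
  from Lim_transform_eventually[OF 1(1) this] 1(2) show ?thesis
    using tendsto_unique[OF at_0_within_wedge_nontrivial[OF c]] by fastforce
qed

lemma qprod_duplication:
  assumes "0 < Re w"
  shows "qprod 1 1 w = qprod 1 (1/2) (2 * w) * qprod 1 1 (2 * w)"
proof -
  have "qprod 1 1 w = (\<Prod>n. 1 - 1 * exp (- (of_nat (Suc n) * w)))"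
    by (simp add: qprod_def add.commute)
  also have "\<dots> = (\<Prod>r<2. qprod 1 (real (Suc r) / real 2) (of_nat 2 * w))"
    by (rule prodinf_residue_classes) (use assms in auto)
  finally show ?thesis by (simp add: numeral_2_eq_2)
qed

lemma qprod_nonzero:
  assumes a: "norm a = 1" and x: "0 < x" and w: "0 < Re w"
  shows "qprod a x w \<noteq> 0"
  unfolding qprod_def
proof (rule prodinf_nonzero)
  show "convergent_prod (\<lambda>m. 1 - a * exp (- (of_real (real m + x) * w)))"
    using a w by (intro convergent_prod_one_minus_exp) auto
  fix m
  have "0 < Re (of_real (real m + x) * w)" using x w by (simp add: add_nonneg_pos)
  from norm_unit_exp_less_1[OF a this]
  show "1 - a * exp (- (of_real (real m + x) * w)) \<noteq> 0" by auto
qed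

text \<open>The constant in Stirling's formula is pinned down by comparing both sides of
  \<open>\<Prod>(1 - q^n) = \<Prod>(1 - q^(2n-1)) \<Prod>(1 - q^(2n))\<close>.\<close>

lemma stirling_limit_1: "stirling_limit 1 = of_real (sqrt (2 * pi))"
proof -
  define A where "A = stirling_limit 1"
  define g where "g w = exp (- (1/2) * Ln w) * exp (- dilog 1 / w)" for w
  have 1: "exp_close 1 (qprod 1 1) (\<lambda>w. A * g w)"
    by (rule exp_close_cong[OF qprod_singular_aux[of 1 1]]) (auto simp: A_def g_def)
  \<comment> \<open>The value Gamma (1/2) = sqrt pi is the external input that fixes the
    constant.\<close>
  have half: "stirling_limit (1/2) = A / of_real (sqrt pi)"
    using stirling_limit_eq[of "1/2"] by (simp add: A_def Gamma_one_half_complex)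
  have "exp_close 1 (qprod 1 (1/2)) (\<lambda>w. A / of_real (sqrt pi) * exp (- dilog 1 / w))"
    by (rule exp_close_cong[OF qprod_singular_aux[of "1/2" 1]]) (auto simp: half)
  from exp_close_mult[OF exp_close_scale[OF this, of 2] exp_close_scale[OF 1, of 2]]
  have 2: "exp_close 1 (qprod 1 1) (\<lambda>w. (A * A / of_real (sqrt pi) * exp (- of_real (ln 2) / 2)) * g w)"
  proof (rule exp_close_cong)
    fix w :: complex assume w: "w \<in> wedge 1" "w \<noteq> 0"
    show "qprod 1 (1/2) (of_real 2 * w) * qprod 1 1 (of_real 2 * w) = qprod 1 1 w"
      by (simp add: qprod_duplication[OF wedge_Re_pos[OF zero_less_one w]])
    have L: "Ln (2 * w) = of_real (ln 2) + Ln w"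
      using Ln_times_of_real[of 2 w] Ln_of_real[of 2] w by simp
    have E: "exp (- dilog 1 / (2 * w)) * exp (- dilog 1 / (2 * w)) = exp (- dilog 1 / w)"
      unfolding exp_add[symmetric] using w by (simp add: field_simps)
    have "exp (- (1/2) * Ln (2 * w)) = exp (- of_real (ln 2) / 2 + - (1/2) * Ln w)"
      unfolding L by (simp add: algebra_simps)
    then have L': "exp (- (1/2) * Ln (2 * w)) = exp (- of_real (ln 2) / 2) * exp (- (1/2) * Ln w)"
      by (simp only: exp_add)
    have "\<alpha> / s * y * (\<alpha> * (l * m * y)) = (\<alpha> * \<alpha> / s * l) * (m * (y * y))" for \<alpha> s y l m :: complex
      by simp
    from this[of A "of_real (sqrt pi)" "exp (- dilog 1 / (2 * w))" "exp (- of_real (ln 2) / 2)" "exp (- (1/2) * Ln w)"]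
    show "A / of_real (sqrt pi) * exp (- dilog 1 / (of_real 2 * w)) * (A * g (of_real 2 * w)) =
        (A * A / of_real (sqrt pi) * exp (- of_real (ln 2) / 2)) * g w"
      by (simp only: g_def E L' of_real_numeral)
  qed simp_all
  \<comment> \<open>The factor exp (- ln 2 / 2) stems from Ln (2 w). The equation is A = A^2 / sqrt
    (2 pi), so only A = 0 has to be excluded, which holds since \<open>qprod\<close> does not
    vanish.\<close>
  have "A = A * A / of_real (sqrt pi) * exp (- of_real (ln 2) / 2)"
    by (rule exp_close_const_unique[OF 1 2]) (auto simp: g_def)
  moreover have "A \<noteq> 0"
  proof -
    obtain e :: "complex \<Rightarrow> complex" where
      "stirling_quot 1 \<longlonglongrightarrow> qprod 1 1 1 * exp (of_real (1 - 1/2) * Ln 1 + dilog 1 / 1 - e 1)"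
      using LIMSEQ_stirling_quot_aux[of 1 1] one_in_wedge[of 1] by (metis norm_one order_refl zero_less_one zero_neq_one)
    from LIMSEQ_unique[OF this LIMSEQ_stirling_quot[of 1]] show ?thesis
      using qprod_nonzero[of 1 1 1] by (auto simp: A_def)
  qed
  ultimately have "A * exp (- of_real (ln 2) / 2) = of_real (sqrt pi)"
    by (simp add: field_simps)
  moreover have "exp (- of_real (ln 2) / 2) = (of_real (inverse (sqrt 2)) :: complex)"
  proof -
    have "exp (- of_real (ln 2) / 2) = (of_real (exp (- (ln 2 / 2))) :: complex)"
      by (simp flip: exp_of_real)
    also have "exp (- (ln 2 / 2)) = inverse (sqrt 2)"
      by (simp add: exp_minus ln_sqrt[symmetric])
    finally show ?thesis .
  qed
  ultimately have "A * of_real (inverse (sqrt 2)) = of_real (sqrt pi)"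
    by (simp only:)
  then have "A = of_real (sqrt pi) * of_real (sqrt 2)"
    by (simp add: field_simps)
  then show ?thesis by (simp add: A_def real_sqrt_mult mult.commute)
qed

lemma qprod_singular:
  assumes "0 < x" "x \<le> 1" "0 < c" "c \<le> 1"
  shows "exp_close c (qprod 1 x)
     (\<lambda>w. of_real (sqrt (2 * pi)) / Gamma (of_real x) * exp (of_real (1/2 - x) * Ln w) * exp (- dilog 1 / w))"
  using qprod_singular_aux[OF assms] stirling_limit_eq[OF assms(1,2)] by (simp only: stirling_limit_1)

text \<open>Exactly one residue s in a period has coefficient 1 and contributes the Gamma value and
  the power of v. The position s is left open: it is 0 for coefficients \<xi>^n and K - 1 for
  coefficients \<zeta>^(n + 1). The step length K v turns the dilogarithm sum into pi^2 / (6 K^2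
  v).\<close>

lemma prodinf_exp_close:
  fixes a :: "nat \<Rightarrow> complex"
  assumes K: "0 < K" and a: "\<And>n. norm (a n) = 1" and per: "\<And>n. a (n + K) = a n"
    and s: "s < K" "a s = 1" "\<And>r. r < K \<Longrightarrow> r \<noteq> s \<Longrightarrow> a r \<noteq> 1"
    and dl: "(\<Sum>r<K. dilog (a r)) = of_real (pi\<^sup>2 / (6 * real K))"
    and c: "0 < c" "c \<le> 1"
  shows "exp_close c (\<lambda>v. \<Prod>n. 1 - a n * exp (- (of_nat (Suc n) * v)))
     (\<lambda>v. of_real (sqrt (2 * pi)) / Gamma (of_real (real (Suc s) / real K)) *
          exp (of_real (1/2 - real (Suc s) / real K) * Ln (of_nat K * v)) *
          (\<Prod>r\<in>{..<K} - {s}. exp (of_real (1/2 - real (Suc r) / real K) * Ln (1 - a r))) *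
          exp (- of_real (pi\<^sup>2) / (6 * of_nat K ^ 2 * v)))"
proof -
  define x where "x r = real (Suc r) / real K" for r
  have x: "0 < x r" "x r \<le> 1" if "r < K" for r using that by (auto simp: x_def)
  define h where "h r v = (if r = s then of_real (sqrt (2 * pi)) / Gamma (of_real (x s)) * exp (of_real (1/2 - x s) * Ln v)
     else exp (of_real (1/2 - x r) * Ln (1 - a r)))" for r v
  define g where "g r v = h r v * exp (- dilog (a r) / v)" for r v
  have "exp_close c (qprod (a r) (x r)) (g r)" if "r < K" for r
  proof (cases "r = s")
    case True
    show ?thesis using qprod_singular[OF x[OF that] c] True s by (simp add: g_def[abs_def] h_def[abs_def])
  next
    case False
    show ?thesis using qprod_regular[OF a s(3)[OF that False] x[OF that] c(1)] False
      by (simp add: g_def[abs_def] h_def[abs_def] mult.commute)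
  qed
  then have "exp_close c (\<lambda>v. \<Prod>r<K. qprod (a r) (x r) (of_real (real K) * v)) (\<lambda>v. \<Prod>r<K. g r (of_real (real K) * v))"
    using K by (intro exp_close_prod exp_close_scale) auto
  then show ?thesis
  proof (rule exp_close_cong)
    fix v assume v: "v \<in> wedge c" "v \<noteq> 0"
    show "(\<Prod>r<K. qprod (a r) (x r) (of_real (real K) * v)) = (\<Prod>n. 1 - a n * exp (- (of_nat (Suc n) * v)))"
      using prodinf_residue_classes[where a = a and v = v, OF K a per wedge_Re_pos[OF c(1) v]] by (simp add: x_def)
    have "(\<Prod>r<K. g r (of_real (real K) * v)) = (\<Prod>r<K. h r (of_nat K * v)) * exp (\<Sum>r<K. - dilog (a r) / (of_nat K * v))"
      by (simp add: g_def prod.distrib exp_sum)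
    also have "(\<Sum>r<K. - dilog (a r) / (of_nat K * v)) = - of_real (pi\<^sup>2) / (6 * of_nat K ^ 2 * v)"
    proof -
      have "(\<Sum>r<K. - dilog (a r) / (of_nat K * v)) = - (\<Sum>r<K. dilog (a r)) / (of_nat K * v)"
        by (simp add: sum_divide_distrib sum_negf)
      then show ?thesis unfolding dl by (simp add: power2_eq_square mult_ac)
    qed
    also have "(\<Prod>r<K. h r (of_nat K * v)) = h s (of_nat K * v) * (\<Prod>r\<in>{..<K} - {s}. h r (of_nat K * v))"
      using s by (intro prod.remove) auto
    also have "(\<Prod>r\<in>{..<K} - {s}. h r (of_nat K * v)) = (\<Prod>r\<in>{..<K} - {s}. exp (of_real (1/2 - x r) * Ln (1 - a r)))"
      by (intro prod.cong) (auto simp: h_def)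
    finally show "(\<Prod>r<K. g r (of_real (real K) * v)) = of_real (sqrt (2 * pi)) / Gamma (of_real (real (Suc s) / real K)) *
          exp (of_real (1/2 - real (Suc s) / real K) * Ln (of_nat K * v)) *
          (\<Prod>r\<in>{..<K} - {s}. exp (of_real (1/2 - real (Suc r) / real K) * Ln (1 - a r))) *
          exp (- of_real (pi\<^sup>2) / (6 * of_nat K ^ 2 * v))"
      by (simp only: h_def x_def if_True simp_thms)
  qed
qed

section \<open>Sums and products over roots of unity\<close>

lemma primitive_unity_root_power_eq_1_iff:
  assumes "primitive_unity_root K \<zeta>"
  shows "\<zeta> ^ n = 1 \<longleftrightarrow> K dvd n"
proof -
  have K: "0 < K" "\<zeta> ^ K = 1" "\<And>d. 0 < d \<Longrightarrow> d < K \<Longrightarrow> \<zeta> ^ d \<noteq> 1"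
    using assms by (auto simp: primitive_unity_root_def)
  have "\<zeta> ^ n = \<zeta> ^ (K * (n div K) + n mod K)" by simp
  also have "\<dots> = \<zeta> ^ (n mod K)" unfolding power_add power_mult by (simp add: K)
  finally have "\<zeta> ^ n = 1 \<longleftrightarrow> \<zeta> ^ (n mod K) = 1" by simp
  also have "\<dots> \<longleftrightarrow> n mod K = 0"
    using K(3)[of "n mod K"] K(1) by (cases "n mod K = 0") auto
  finally show ?thesis by (simp add: dvd_eq_mod_eq_0)
qed

lemma norm_primitive_unity_root:
  assumes "primitive_unity_root K \<zeta>"
  shows "norm \<zeta> = 1"
  using assms power_eq_1_iff[of \<zeta> K] unfolding primitive_unity_root_def by auto

text \<open>Orthogonality: the sum of \<zeta>^(r n) over r is K if K divides n and 0 otherwise. What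
  remains is the sum of K / (K m)^2, which is (pi^2 / 6) / K.\<close>

lemma sum_dilog_unity_roots:
  assumes p: "primitive_unity_root K \<zeta>"
  shows "(\<Sum>r<K. dilog (\<zeta> ^ r)) = of_real (pi\<^sup>2 / (6 * real K))"
proof -
  have K: "0 < K" using p by (simp add: primitive_unity_root_def)
  define f where "f n = (\<Sum>r<K. (\<zeta> ^ r) ^ Suc n / of_nat (Suc n) ^ 2)" for n
  have "f sums (\<Sum>r<K. dilog (\<zeta> ^ r))"
    unfolding f_def dilog_def
    by (intro sums_sum summable_sums summable_dilog)
       (simp add: norm_power norm_primitive_unity_root[OF p])
  \<comment> \<open>The zero-based positions n for which n + 1 is a multiple of K.\<close>
  define g where "g m = K * Suc m - 1" for m
  have Sg: "Suc (g m) = K * Suc m" for m using K by (simp add: g_def)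
  have f_eq: "f n = (if K dvd Suc n then of_nat K / of_nat (Suc n) ^ 2 else 0)" for n
  proof -
    define y where "y = \<zeta> ^ Suc n"
    have "y ^ K = 1" using p unfolding y_def power_mult[symmetric]
      by (subst primitive_unity_root_power_eq_1_iff[OF p]) simp
    then have "(\<Sum>r<K. y ^ r) = (if y = 1 then of_nat K else 0)"
      using geometric_sum[of y K] by auto
    moreover have "f n = (\<Sum>r<K. y ^ r) / of_nat (Suc n) ^ 2"
      unfolding f_def sum_divide_distrib y_def power_mult[symmetric] by (simp only: mult.commute)
    moreover have "y = 1 \<longleftrightarrow> K dvd Suc n"
      unfolding y_def by (rule primitive_unity_root_power_eq_1_iff[OF p])
    ultimately show ?thesis by simp
  qed
  have "strict_mono g"
  proof (rule strict_monoI)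
    fix m n :: nat assume "m < n"
    then have "K * Suc m < K * Suc n" using K by simp
    then have "Suc (g m) < Suc (g n)" unfolding Sg .
    then show "g m < g n" by simp
  qed
  moreover have "f n = 0" if "n \<notin> range g" for n
  proof (rule ccontr)
    assume "f n \<noteq> 0"
    then obtain j where j: "Suc n = K * j" unfolding f_eq by (auto split: if_splits elim: dvdE)
    then obtain m where "j = Suc m" by (cases j) auto
    then have "n = g m" using j Sg[of m] by simp
    with that show False by simp
  qed
  ultimately have "(\<lambda>m. f (g m)) sums (\<Sum>r<K. dilog (\<zeta> ^ r))"
    using \<open>f sums _\<close> by (subst sums_mono_reindex) auto
  moreover have "f (g m) = of_real (1 / real (Suc m) ^ 2 / real K)" for m
  proof -
    have "k / (k * s)\<^sup>2 = 1 / s\<^sup>2 / k" for k s :: complex by (simp add: power2_eq_square)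
    from this[of "of_nat K" "of_nat (Suc m)"] show ?thesis
      unfolding f_eq Sg by (simp del: of_nat_Suc mult_Suc_right)
  qed
  moreover have "(\<lambda>m. 1 / real (Suc m) ^ 2 / real K) sums (pi\<^sup>2 / 6 / real K)"
    using sums_divide[OF inverse_squares_sums, of "real K"] by (simp add: add.commute)
  then have "(\<lambda>m. complex_of_real (1 / real (Suc m) ^ 2 / real K)) sums of_real (pi\<^sup>2 / 6 / real K)"
    by (subst sums_of_real_iff)
  ultimately show ?thesis using sums_unique2 by fastforce
qed

text \<open>The product of X - \<zeta>^r over 0 < r < K is 1 + X + ... + X^(K - 1), as both agree at
  K - 1 points and in the top coefficient; then X = 1.\<close>

lemma prod_one_minus_unity_roots:
  assumes p: "primitive_unity_root K \<zeta>"
  shows "(\<Prod>r=1..<K. 1 - \<zeta> ^ r) = of_nat K"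
proof -
  have K: "0 < K" using p by (simp add: primitive_unity_root_def)
  define P where "P = (\<Prod>r=1..<K. [:- (\<zeta> ^ r), 1:])"
  define Q :: "complex poly" where "Q = (\<Sum>i<K. monom 1 i)"
  have inj: "inj_on (\<lambda>r. \<zeta> ^ r) {1..<K}"
  proof (rule linorder_inj_onI)
    fix r s assume rs: "r < s" "r \<in> {1..<K}" "s \<in> {1..<K}"
    have "\<not> K dvd (s - r)" using rs by (auto dest: dvd_imp_le)
    then have "\<zeta> ^ (s - r) \<noteq> 1" using primitive_unity_root_power_eq_1_iff[OF p] by simp
    moreover have "\<zeta> ^ s = \<zeta> ^ r * \<zeta> ^ (s - r)" using rs by (simp flip: power_add)
    moreover have "\<zeta> ^ r \<noteq> 0" using norm_primitive_unity_root[OF p] by auto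
    ultimately show "\<zeta> ^ r \<noteq> \<zeta> ^ s" by auto
  qed auto
  have "P = Q"
  proof (rule poly_eqI_degree_lead_coeff[where n = "K - 1" and A = "(\<lambda>r. \<zeta> ^ r) ` {1..<K}"])
    have dP: "degree P = K - 1" unfolding P_def by (subst degree_prod_eq_sum_degree) auto
    moreover have "lead_coeff P = 1" unfolding P_def by (subst lead_coeff_prod) auto
    ultimately have "poly.coeff P (K - 1) = 1" by simp
    moreover have "poly.coeff Q (K - 1) = 1" using K by (simp add: Q_def coeff_sum if_distrib)
    ultimately show "poly.coeff P (K - 1) = poly.coeff Q (K - 1)" by simp
    show "K - 1 \<le> card ((\<lambda>r. \<zeta> ^ r) ` {1..<K})" using inj by (simp add: card_image)
    show "degree P \<le> K - 1" using dP by simp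
    show "degree Q \<le> K - 1" unfolding Q_def
      by (intro degree_sum_le order_trans[OF degree_monom_le]) auto
    fix y assume "y \<in> (\<lambda>r. \<zeta> ^ r) ` {1..<K}"
    then obtain r where r: "y = \<zeta> ^ r" "1 \<le> r" "r < K" by auto
    have "\<not> K dvd r" using r by (auto dest: dvd_imp_le)
    then have "y \<noteq> 1" using primitive_unity_root_power_eq_1_iff[OF p] r by simp
    moreover have "y ^ K = 1" unfolding r power_mult[symmetric]
      by (subst primitive_unity_root_power_eq_1_iff[OF p]) simp
    ultimately have "poly Q y = 0" using geometric_sum[of y K] by (simp add: Q_def poly_sum poly_monom)
    moreover have "poly P y = 0" using r by (auto simp: P_def poly_prod)
    ultimately show "poly P y = poly Q y" by simp
  qed
  then have "poly P 1 = poly Q 1" by simp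
  then show ?thesis by (simp add: P_def Q_def poly_prod poly_sum poly_monom)
qed

lemma Re_one_minus_pos:
  assumes "norm a = 1" "a \<noteq> 1"
  shows "0 < Re (1 - a)"
proof -
  have "Re a \<noteq> 1"
  proof
    assume R: "Re a = 1"
    then have "Im a = 0" using assms(1) cmod_power2[of a] by simp
    with R assms(2) show False by (simp add: complex_eq_iff)
  qed
  then show ?thesis using complex_Re_le_cmod[of a] assms(1) by simp
qed

lemma Ln_one_minus_cnj:
  assumes "norm a = 1" "a \<noteq> 1"
  shows "Ln (1 - cnj a) = cnj (Ln (1 - a))"
proof -
  have "1 - a \<notin> \<real>\<^sub>\<le>\<^sub>0" using Re_one_minus_pos[OF assms] by (auto simp: complex_nonpos_Reals_iff)
  from cnj_Ln[OF this] show ?thesis by simp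
qed

lemma unity_root_power_diff:
  assumes "norm \<zeta> = 1" "\<zeta> ^ K = 1" "r \<le> K"
  shows "\<zeta> ^ (K - r) = cnj (\<zeta> ^ r)"
proof -
  have "\<zeta> ^ r * \<zeta> ^ (K - r) = 1" using assms by (simp flip: power_add)
  moreover have "\<zeta> ^ r * cnj (\<zeta> ^ r) = 1"
    using assms complex_norm_square[of "\<zeta> ^ r"] by (simp add: norm_power)
  moreover have "\<zeta> ^ r \<noteq> 0" using assms by auto
  ultimately show ?thesis by (metis mult_cancel_left)
qed

text \<open>The product of the numbers 1 - \<zeta>^r gives the sum of logarithms only modulo 2 pi i.
  The reflection r to K - r conjugates the summands, so the sum is real and the ambiguity
  disappears.\<close>

lemma sum_Ln_one_minus_unity_roots:
  assumes p: "primitive_unity_root K \<zeta>"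
  shows "(\<Sum>r=1..<K. Ln (1 - \<zeta> ^ r)) = of_real (ln (real K))"
proof -
  have K: "0 < K" "\<zeta> ^ K = 1" using p by (auto simp: primitive_unity_root_def)
  note nrm = norm_primitive_unity_root[OF p]
  define S where "S = (\<Sum>r=1..<K. Ln (1 - \<zeta> ^ r))"
  have ne: "\<zeta> ^ r \<noteq> 1" if "r \<in> {1..<K}" for r
    using that primitive_unity_root_power_eq_1_iff[OF p, of r] by (auto dest: dvd_imp_le)
  have "S = (\<Sum>r=1..<K. Ln (1 - \<zeta> ^ (K - r)))"
    unfolding S_def by (rule sum.reindex_bij_witness[of _ "\<lambda>r. K - r" "\<lambda>r. K - r"]) auto
  also have "\<dots> = (\<Sum>r=1..<K. cnj (Ln (1 - \<zeta> ^ r)))"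
    using ne nrm K(2) by (intro sum.cong refl) (simp add: unity_root_power_diff Ln_one_minus_cnj[symmetric] norm_power)
  finally have "S = cnj S" by (simp add: S_def)
  then have SR: "S = of_real (Re S)" by (simp add: complex_eq_iff)
  have "exp S = of_nat K"
    unfolding S_def prod_one_minus_unity_roots[OF p, symmetric] exp_sum[OF finite_atLeastLessThan]
    using ne by (intro prod.cong refl exp_Ln) auto
  then have "exp (Re S) = real K"
    by (metis SR exp_of_real of_real_eq_iff of_real_of_nat_eq)
  then have "Re S = ln (real K)" by (metis ln_exp)
  with SR have "S = of_real (ln (real K))" by (simp only:)
  then show ?thesis by (simp only: S_def)
qed

subsection \<open>The three products\<close>

text \<open>The coefficient is constant, so a single \<open>qprod\<close> with x = 1 suffices: the
  exponent 1/2 - 1 yields the inverse square root, and an index shift identifies \<xi> \<Phi>(\<xi>,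
  2, 1) with \<open>dilog \<xi>\<close>.\<close>

lemma F1_exp_close:
  assumes \<xi>: "norm \<xi> = 1" "\<xi> \<noteq> 1" and c: "0 < c"
  shows "exp_close c (\<lambda>z. F1 \<xi> (exp (- z)))
    (\<lambda>z. 1 / csqrt (1 - \<xi>) * exp (- (\<xi> * lerch_phi \<xi> 2 1 / z)))"
proof (rule exp_close_cong[OF qprod_regular[OF \<xi> _ _ c, of 1]])
  fix z :: complex
  have "exp (- z) ^ Suc m = exp (- (of_real (real m + 1) * z))" for m
    unfolding exp_of_nat_mult[symmetric] by (simp add: add.commute)
  then show "qprod \<xi> 1 z = F1 \<xi> (exp (- z))"
    by (simp only: qprod_def F1_def)
  have "\<xi> * lerch_phi \<xi> 2 1 = dilog \<xi>"
  proof -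
    have eq: "\<xi> ^ Suc n / of_nat (Suc n) ^ 2 = \<xi> * (\<xi> ^ n / (of_nat n + 1) powr 2)" for n
      by (simp add: add.commute)
    have "summable (\<lambda>n. \<xi> * (\<xi> ^ n / (of_nat n + 1) powr 2))"
      unfolding eq[symmetric] by (rule summable_dilog) (use \<xi> in simp)
    then have "summable (\<lambda>n. \<xi> ^ n / (of_nat n + 1) powr 2)"
      using \<xi> by (subst (asm) summable_cmult_iff) auto
    then show ?thesis
      unfolding lerch_phi_def dilog_def eq by (rule suminf_mult[symmetric])
  qed
  moreover have "1 / csqrt (1 - \<xi>) = exp (of_real (1/2 - 1) * Ln (1 - \<xi>))"
  proof -
    have "csqrt (1 - \<xi>) = exp (Ln (1 - \<xi>) / 2)" by (rule csqrt_exp_Ln) (use \<xi> in auto)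
    moreover have "of_real (1/2 - 1) * L = - (L / 2)" for L :: complex by simp
    ultimately show ?thesis by (simp only: exp_minus inverse_eq_divide)
  qed
  ultimately show "exp (- dilog \<xi> / z) * exp (of_real (1/2 - 1) * Ln (1 - \<xi>)) =
      1 / csqrt (1 - \<xi>) * exp (- (\<xi> * lerch_phi \<xi> 2 1 / z))"
    by simp
qed simp_all

text \<open>The coefficients are \<xi>^n, so the singular residue is 0 with x = 1 / b, whence Gamma
  (1 / b). With s = 1/2 - 1/b the exponents split as s - r / b. By the sum of logarithms the parts
  with s multiply to b^s, which changes (b z)^s into (b^2 z)^s; the parts - r / b form the stated
  product.\<close>

lemma F3_exp_close:
  assumes p: "primitive_unity_root b \<xi>" and c: "0 < c" "c \<le> 1"
  shows "exp_close c (\<lambda>z. F3 \<xi> (exp (- z)))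
    (\<lambda>z. of_real (sqrt (2 * pi)) * (of_nat b ^ 2 * z) powr (1 / 2 - 1 / of_nat b)
               / Gamma (1 / of_nat b)
             * (\<Prod>j = 1..b - 1. 1 / (1 - \<xi> ^ j) powr (of_nat j / of_nat b))
             * exp (- (of_real pi ^ 2 / (6 * of_nat b ^ 2 * z))))"
proof -
  have b: "0 < b" "\<xi> ^ b = 1" using p by (auto simp: primitive_unity_root_def)
  have nrm: "norm \<xi> = 1" by (rule norm_primitive_unity_root[OF p])
  have ne: "\<xi> ^ r \<noteq> 1" if "0 < r" "r < b" for r
    using that p by (simp add: primitive_unity_root_def)
  have main: "exp_close c (\<lambda>v. \<Prod>n. 1 - \<xi> ^ n * exp (- (of_nat (Suc n) * v)))
     (\<lambda>v. of_real (sqrt (2 * pi)) / Gamma (of_real (real (Suc 0) / real b)) *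
          exp (of_real (1/2 - real (Suc 0) / real b) * Ln (of_nat b * v)) *
          (\<Prod>r\<in>{..<b} - {0}. exp (of_real (1/2 - real (Suc r) / real b) * Ln (1 - \<xi> ^ r))) *
          exp (- of_real (pi\<^sup>2) / (6 * of_nat b ^ 2 * v)))"
    by (rule prodinf_exp_close[OF b(1) _ _ b(1) _ _ sum_dilog_unity_roots[OF p] c])
       (use nrm b ne in \<open>auto simp: norm_power power_add\<close>)
  define s where "s = 1/2 - 1 / real b"
  have P: "(\<Prod>r\<in>{..<b} - {0}. exp (of_real (1/2 - real (Suc r) / real b) * Ln (1 - \<xi> ^ r))) =
      exp (of_real s * of_real (ln (real b))) * (\<Prod>j = 1..b - 1. 1 / (1 - \<xi> ^ j) powr (of_nat j / of_nat b))"
  proof -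
    have sets: "{..<b} - {0} = {1..<b}" "{1..b - 1} = {1..<b}" using b by auto
    have "(\<Prod>r=1..<b. exp (of_real (1/2 - real (Suc r) / real b) * Ln (1 - \<xi> ^ r))) =
      (\<Prod>r=1..<b. exp (of_real s * Ln (1 - \<xi> ^ r)) * (1 / (1 - \<xi> ^ r) powr (of_nat r / of_nat b)))"
    proof (intro prod.cong refl)
      fix r assume r: "r \<in> {1..<b}"
      have "of_real (1/2 - real (Suc r) / real b) * Ln (1 - \<xi> ^ r) =
         of_real s * Ln (1 - \<xi> ^ r) - of_nat r / of_nat b * Ln (1 - \<xi> ^ r)"
        by (simp add: s_def add_divide_distrib algebra_simps)
      then have "exp (of_real (1/2 - real (Suc r) / real b) * Ln (1 - \<xi> ^ r)) =
         exp (of_real s * Ln (1 - \<xi> ^ r)) / exp (of_nat r / of_nat b * Ln (1 - \<xi> ^ r))"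
        by (simp only: exp_diff)
      then show "exp (of_real (1/2 - real (Suc r) / real b) * Ln (1 - \<xi> ^ r)) =
         exp (of_real s * Ln (1 - \<xi> ^ r)) * (1 / (1 - \<xi> ^ r) powr (of_nat r / of_nat b))"
        using ne[of r] r by (simp add: powr_def)
    qed
    also have "\<dots> = exp (of_real s * (\<Sum>r=1..<b. Ln (1 - \<xi> ^ r))) * (\<Prod>r=1..<b. 1 / (1 - \<xi> ^ r) powr (of_nat r / of_nat b))"
      by (simp only: prod.distrib exp_sum[OF finite_atLeastLessThan] sum_distrib_left)
    finally show ?thesis unfolding sets sum_Ln_one_minus_unity_roots[OF p] .
  qed
  show ?thesis
  proof (rule exp_close_cong[OF main])
    fix z assume z: "z \<in> wedge c" "z \<noteq> 0"
    have "\<xi> \<noteq> 0" using nrm by auto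
    then have "inverse \<xi> * (\<xi> * exp (- z)) ^ Suc n = \<xi> ^ n * exp (- (of_nat (Suc n) * z))" for n
      by (simp add: power_mult_distrib exp_of_nat_mult[symmetric] algebra_simps exp_minus[symmetric] exp_add[symmetric])
    then show "(\<Prod>n. 1 - \<xi> ^ n * exp (- (of_nat (Suc n) * z))) = F3 \<xi> (exp (- z))"
      by (simp only: F3_def)
    have "Ln (of_real (real b) * (of_nat b * z)) = Ln (of_real (real b)) + Ln (of_nat b * z)"
      using Ln_times_of_real[of "real b" "of_nat b * z"] Ln_of_real[of "real b"] b z by simp
    then have L: "Ln (of_nat b ^ 2 * z) = of_real (ln (real b)) + Ln (of_nat b * z)"
      using Ln_of_real[of "real b"] b by (simp add: power2_eq_square mult.assoc)
    have "(of_nat b ^ 2 * z) powr (1 / 2 - 1 / of_nat b) = exp (of_real s * Ln (of_nat b ^ 2 * z))"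
      using b z by (simp add: powr_def s_def)
    also have "of_real s * Ln (of_nat b ^ 2 * z) = of_real s * of_real (ln (real b)) + of_real s * Ln (of_nat b * z)"
      unfolding L by (rule distrib_left)
    finally have pw: "(of_nat b ^ 2 * z) powr (1 / 2 - 1 / of_nat b) =
        exp (of_real s * of_real (ln (real b))) * exp (of_real s * Ln (of_nat b * z))"
      by (simp only: exp_add)
    have s': "1/2 - real (Suc 0) / real b = s" "complex_of_real (real (Suc 0) / real b) = 1 / of_nat b"
      by (simp_all add: s_def)
    show "of_real (sqrt (2 * pi)) / Gamma (of_real (real (Suc 0) / real b)) *
          exp (of_real (1/2 - real (Suc 0) / real b) * Ln (of_nat b * z)) *
          (\<Prod>r\<in>{..<b} - {0}. exp (of_real (1/2 - real (Suc r) / real b) * Ln (1 - \<xi> ^ r))) *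
          exp (- of_real (pi\<^sup>2) / (6 * of_nat b ^ 2 * z)) =
        of_real (sqrt (2 * pi)) * (of_nat b ^ 2 * z) powr (1 / 2 - 1 / of_nat b)
               / Gamma (1 / of_nat b)
             * (\<Prod>j = 1..b - 1. 1 / (1 - \<xi> ^ j) powr (of_nat j / of_nat b))
             * exp (- (of_real pi ^ 2 / (6 * of_nat b ^ 2 * z)))"
      unfolding P pw s' by simp
  qed
qed

section \<open>Dedekind sums and the Euler product near a root of unity\<close>

lemma primitive_unity_root_exp:
  fixes H :: int
  assumes K: "0 < K" and cop: "coprime H (int K)"
  shows "primitive_unity_root K (exp (2 * of_real pi * \<i> * of_int H / of_nat K))"
proof -
  define \<zeta> where "\<zeta> = exp (2 * of_real pi * \<i> * of_int H / of_nat K)"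
  have pw: "\<zeta> ^ d = exp (2 * of_real pi * \<i> * of_int (H * int d) / of_nat K)" for d
    unfolding \<zeta>_def exp_of_nat_mult[symmetric] by (simp add: mult_ac)
  have "\<zeta> ^ d = 1 \<longleftrightarrow> int K dvd H * int d" for d
  proof
    assume "\<zeta> ^ d = 1"
    then obtain n :: int where "2 * pi * (H * int d) / K = of_int (2 * n) * pi"
      unfolding pw exp_eq_1 by auto
    then have "real_of_int (H * int d) = real_of_int (n * int K)"
      using K by (simp add: field_simps)
    then have "H * int d = n * int K" by (simp only: of_int_eq_iff)
    then show "int K dvd H * int d" by simp
  next
    assume "int K dvd H * int d"
    then obtain n where n: "H * int d = int K * n" by (rule dvdE)
    have "2 * of_real pi * \<i> * of_int (H * int d) / of_nat K = (2 * of_int n * of_real pi) * \<i>"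
      unfolding n using K by simp
    then show "\<zeta> ^ d = 1" unfolding pw using exp_integer_2pi[of "of_int n"] by simp
  qed
  moreover have "int K dvd H * int d \<longleftrightarrow> K dvd d" for d
    using cop by (simp add: coprime_dvd_mult_right_iff coprime_commute)
  ultimately show ?thesis
    unfolding primitive_unity_root_def \<zeta>_def[symmetric] using K by (auto dest: dvd_imp_le)
qed

text \<open>For 0 < t < 1, 1 - exp (2 pi i t) = 2 sin (pi t) exp (i pi (t - 1/2)) with positive
  modulus and argument between - pi / 2 and pi / 2, hence principal. Here t is the fractional part
  of y.\<close>

lemma Im_Ln_one_minus_exp:
  assumes y: "y \<notin> \<int>"
  shows "Im (Ln (1 - exp (2 * of_real pi * \<i> * of_real y))) = pi * sawtooth y"
proof -
  define t where "t = frac y"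
  have t: "0 < t" "t < 1" using y frac_lt_1[of y] frac_gt_0_iff[of y] by (auto simp: t_def)
  have "exp (2 * of_real pi * \<i> * of_real y) = exp (2 * of_real pi * \<i> * of_real t)"
  proof -
    have "2 * of_real pi * \<i> * of_real y = 2 * of_real pi * \<i> * of_real t + \<i> * (of_int \<lfloor>y\<rfloor> * (of_real pi * 2))"
      by (simp add: t_def frac_def algebra_simps)
    then show ?thesis by (simp only: exp_plus_2pin)
  qed
  also have "1 - exp (2 * of_real pi * \<i> * of_real t) = exp (of_real (ln (2 * sin (pi * t))) + \<i> * of_real (pi * (t - 1/2)))"
  proof -
    have sin_pos: "0 < sin (pi * t)" using t by (intro sin_gt_zero) auto
    have "exp (of_real (ln (2 * sin (pi * t))) + \<i> * of_real (pi * (t - 1/2))) = of_real (2 * sin (pi * t)) * cis (pi * t - pi / 2)"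
    proof -
      have "exp (of_real (ln (2 * sin (pi * t)))) = complex_of_real (2 * sin (pi * t))"
        using sin_pos by (simp only: exp_of_real) simp
      moreover have "exp (\<i> * of_real (pi * (t - 1/2))) = cis (pi * t - pi / 2)"
        by (simp add: cis_conv_exp algebra_simps)
      ultimately show ?thesis by (simp only: exp_add)
    qed
    also have "\<dots> = 1 - cis (2 * (pi * t))"
      by (simp add: complex_eq_iff cos_diff sin_diff cos_double_sin sin_double power2_eq_square)
    also have "cis (2 * (pi * t)) = exp (2 * of_real pi * \<i> * of_real t)"
      by (simp add: cis_conv_exp mult_ac)
    finally show ?thesis by simp
  qed
  finally have "Ln (1 - exp (2 * of_real pi * \<i> * of_real y)) = of_real (ln (2 * sin (pi * t))) + \<i> * of_real (pi * (t - 1/2))"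
  proof (intro Ln_unique)
    have "\<bar>t - 1/2\<bar> < 1" using t by auto
    then have "pi * \<bar>t - 1/2\<bar> < pi * 1" by (intro mult_strict_left_mono) auto
    then have "\<bar>pi * (t - 1/2)\<bar> < pi" by (simp add: abs_mult)
    moreover have "Im (of_real (ln (2 * sin (pi * t))) + \<i> * of_real (pi * (t - 1/2))) = pi * (t - 1/2)"
      by simp
    ultimately show "- pi < Im (of_real (ln (2 * sin (pi * t))) + \<i> * of_real (pi * (t - 1/2)))"
       "Im (of_real (ln (2 * sin (pi * t))) + \<i> * of_real (pi * (t - 1/2))) \<le> pi"
      by linarith+
  qed simp
  then have "Im (Ln (1 - exp (2 * of_real pi * \<i> * of_real y))) =
      Im (of_real (ln (2 * sin (pi * t))) + \<i> * of_real (pi * (t - 1/2)))"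
    by (simp only:)
  also have "\<dots> = pi * (t - 1/2)" by simp
  finally show ?thesis using y by (simp only: sawtooth_def t_def frac_def if_False)
qed

text \<open>Under \<open>r \<mapsto> K - r\<close> the sawtooth changes sign and the logarithm is conjugated, so only
  the arguments of the factors \<open>1 - \<zeta> ^ r\<close> survive; they are sawtooth values again.\<close>

lemma sum_sawtooth_Ln_eq_dedekind_sum:
  fixes H :: int
  assumes K: "0 < K" and cop: "coprime H (int K)"
  defines "\<zeta> \<equiv> exp (2 * of_real pi * \<i> * of_int H / of_nat K)"
  shows "(\<Sum>r=1..<K. of_real (real r / real K - 1/2) * Ln (1 - \<zeta> ^ r)) = of_real pi * \<i> * of_real (dedekind_sum H K)"
proof -
  have p: "primitive_unity_root K \<zeta>" unfolding \<zeta>_def by (rule primitive_unity_root_exp[OF K cop])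
  have \<zeta>: "norm \<zeta> = 1" "\<zeta> ^ K = 1" "\<And>r. r \<in> {1..<K} \<Longrightarrow> \<zeta> ^ r \<noteq> 1"
    using p norm_primitive_unity_root[OF p] by (auto simp: primitive_unity_root_def)
  define T where "T = (\<Sum>r=1..<K. of_real (real r / real K - 1/2) * Ln (1 - \<zeta> ^ r))"
  have "T = (\<Sum>r=1..<K. of_real (real (K - r) / real K - 1/2) * Ln (1 - \<zeta> ^ (K - r)))"
    unfolding T_def by (rule sum.reindex_bij_witness[of _ "\<lambda>r. K - r" "\<lambda>r. K - r"]) auto
  also have "\<dots> = (\<Sum>r=1..<K. - cnj (of_real (real r / real K - 1/2) * Ln (1 - \<zeta> ^ r)))"
  proof (intro sum.cong refl)
    fix r assume r: "r \<in> {1..<K}"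
    have "real (K - r) / real K - 1/2 = - (real r / real K - 1/2)"
      using r by (simp add: of_nat_diff diff_divide_distrib)
    moreover have "Ln (1 - \<zeta> ^ (K - r)) = cnj (Ln (1 - \<zeta> ^ r))"
      using r \<zeta> Ln_one_minus_cnj[of "\<zeta> ^ r"] unity_root_power_diff[of \<zeta> K r] by (simp add: norm_power)
    ultimately show "of_real (real (K - r) / real K - 1/2) * Ln (1 - \<zeta> ^ (K - r)) =
        - cnj (of_real (real r / real K - 1/2) * Ln (1 - \<zeta> ^ r))"
      by (simp only: of_real_minus complex_cnj_mult complex_cnj_complex_of_real mult_minus_left)
  qed
  also have "\<dots> = - cnj T" by (simp add: T_def sum_negf)
  finally have "T = - cnj T" .
  then have "Re T = 0" by (simp add: complex_eq_iff)
  moreover have "Im T = pi * dedekind_sum H K"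
  proof -
    have summand: "Im (of_real (real r / real K - 1/2) * Ln (1 - \<zeta> ^ r)) =
        pi * (sawtooth (real r / real K) * sawtooth (of_int (H * int r) / real K))" if r: "r \<in> {1..<K}" for r
    proof -
      have ni: "of_int (H * int r) / real K \<notin> \<int>"
      proof
        assume "of_int (H * int r) / real K \<in> \<int>"
        then obtain n where "of_int (H * int r) / real K = of_int n" by (rule Ints_cases)
        then have "real_of_int (H * int r) = real_of_int (n * int K)" using K by (simp add: field_simps)
        then have "H * int r = n * int K" by (simp only: of_int_eq_iff)
        then have "int K dvd H * int r" by simp
        then have "K dvd r" using cop by (simp add: coprime_dvd_mult_right_iff coprime_commute)
        then show False using r by (auto dest: dvd_imp_le)
      qed
      have "\<zeta> ^ r = exp (2 * of_real pi * \<i> * of_real (of_int (H * int r) / real K))"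
        unfolding \<zeta>_def exp_of_nat_mult[symmetric] by (simp add: mult_ac)
      then have "Im (Ln (1 - \<zeta> ^ r)) = pi * sawtooth (of_int (H * int r) / real K)"
        using Im_Ln_one_minus_exp[OF ni] by simp
      moreover have "sawtooth (real r / real K) = real r / real K - 1/2"
      proof -
        have "0 < real r / real K" "real r / real K < 1" using r by auto
        then have "\<lfloor>real r / real K\<rfloor> = 0" by (simp add: floor_eq_iff)
        moreover from this have "real r / real K \<notin> \<int>"
          using \<open>0 < real r / real K\<close> by (metis Ints_cases floor_of_int less_irrefl of_int_0)
        ultimately show ?thesis by (simp add: sawtooth_def)
      qed
      ultimately show ?thesis by simp
    qed
    have "Im T = (\<Sum>r=1..<K. pi * (sawtooth (real r / real K) * sawtooth (of_int (H * int r) / real K)))"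
      unfolding T_def Im_sum by (intro sum.cong refl summand)
    \<comment> \<open>The Dedekind sum also runs over r = 0, whose term vanishes because the
      sawtooth is 0 at integers.\<close>
    also have "\<dots> = (\<Sum>r<K. pi * (sawtooth (real r / real K) * sawtooth (of_int (H * int r) / real K)))"
      by (intro sum.mono_neutral_left) (auto simp: sawtooth_def Suc_le_eq)
    finally show ?thesis by (simp add: dedekind_sum_def sum_distrib_left)
  qed
  ultimately show ?thesis unfolding T_def[symmetric] by (simp add: complex_eq_iff)
qed

text \<open>The singular residue is K - 1 with x = 1, so Gamma contributes 1 and K v the exponent
  -1/2. The regular factors have weights 1/2 - r / K, the negatives of those in the Dedekind sum
  identity, hence the inverse of \<open>omega\<close>.\<close>

lemma euler_product_exp_close:
  fixes H :: int
  assumes K: "0 < K" and cop: "coprime H (int K)" and c: "0 < c" "c \<le> 1"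
  defines "\<zeta> \<equiv> exp (2 * of_real pi * \<i> * of_int H / of_nat K)"
  shows "exp_close c (\<lambda>v. \<Prod>n. 1 - (\<zeta> * exp (- v)) ^ Suc n)
    (\<lambda>v. inverse (omega H K) * (of_real (sqrt (2 * pi)) * exp (- (1/2) * Ln (of_nat K * v))) *
         exp (- of_real (pi\<^sup>2) / (6 * of_nat K ^ 2 * v)))"
proof -
  have p: "primitive_unity_root K \<zeta>" unfolding \<zeta>_def by (rule primitive_unity_root_exp[OF K cop])
  have \<zeta>: "norm \<zeta> = 1" "\<zeta> ^ K = 1"
    using p norm_primitive_unity_root[OF p] by (auto simp: primitive_unity_root_def)
  have SK: "Suc (K - 1) = K" using K by simp
  have "(\<Sum>r<K. dilog (\<zeta> ^ Suc r)) = (\<Sum>r<K. dilog (\<zeta> ^ r))"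
    using sum.lessThan_Suc_shift[of "\<lambda>r. dilog (\<zeta> ^ r)" K] sum.lessThan_Suc[of "\<lambda>r. dilog (\<zeta> ^ r)" K] \<zeta>
    by simp
  then have dl: "(\<Sum>r<K. dilog (\<zeta> ^ Suc r)) = of_real (pi\<^sup>2 / (6 * real K))"
    using sum_dilog_unity_roots[OF p] by simp
  have main: "exp_close c (\<lambda>v. \<Prod>n. 1 - \<zeta> ^ Suc n * exp (- (of_nat (Suc n) * v)))
     (\<lambda>v. of_real (sqrt (2 * pi)) / Gamma (of_real (real (Suc (K - 1)) / real K)) *
          exp (of_real (1/2 - real (Suc (K - 1)) / real K) * Ln (of_nat K * v)) *
          (\<Prod>r\<in>{..<K} - {K - 1}. exp (of_real (1/2 - real (Suc r) / real K) * Ln (1 - \<zeta> ^ Suc r))) *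
          exp (- of_real (pi\<^sup>2) / (6 * of_nat K ^ 2 * v)))"
  proof (rule prodinf_exp_close[where a = "\<lambda>n. \<zeta> ^ Suc n", OF K _ _ _ _ _ dl c])
    show "\<zeta> ^ Suc r \<noteq> 1" if "r < K" "r \<noteq> K - 1" for r
      using that p unfolding primitive_unity_root_def by (auto dest!: spec[of _ "Suc r"])
    show "\<zeta> ^ Suc (K - 1) = 1" unfolding SK by (rule \<zeta>(2))
  qed (use \<zeta> K in \<open>auto simp: norm_power power_add norm_mult\<close>)
  have P: "(\<Prod>r\<in>{..<K} - {K - 1}. exp (of_real (1/2 - real (Suc r) / real K) * Ln (1 - \<zeta> ^ Suc r))) = inverse (omega H K)"
  proof -
    have "(\<Prod>r\<in>{..<K} - {K - 1}. exp (of_real (1/2 - real (Suc r) / real K) * Ln (1 - \<zeta> ^ Suc r))) =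
       (\<Prod>r=1..<K. exp (of_real (1/2 - real r / real K) * Ln (1 - \<zeta> ^ r)))"
      by (rule prod.reindex_bij_witness[of _ "\<lambda>r. r - 1" Suc]) auto
    also have "\<dots> = exp (\<Sum>r=1..<K. of_real (1/2 - real r / real K) * Ln (1 - \<zeta> ^ r))"
      by (simp only: exp_sum[OF finite_atLeastLessThan])
    also have "(\<Sum>r=1..<K. of_real (1/2 - real r / real K) * Ln (1 - \<zeta> ^ r)) =
        - (\<Sum>r=1..<K. of_real (real r / real K - 1/2) * Ln (1 - \<zeta> ^ r))"
      unfolding sum_negf[symmetric] by (intro sum.cong refl) (simp add: algebra_simps)
    also have "\<dots> = - (of_real pi * \<i> * of_real (dedekind_sum H K))"
      unfolding \<zeta>_def sum_sawtooth_Ln_eq_dedekind_sum[OF K cop] ..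
    finally show ?thesis using cop by (simp add: omega_def exp_minus)
  qed
  show ?thesis
  proof (rule exp_close_cong[OF main])
    fix v :: complex
    show "(\<Prod>n. 1 - \<zeta> ^ Suc n * exp (- (of_nat (Suc n) * v))) = (\<Prod>n. 1 - (\<zeta> * exp (- v)) ^ Suc n)"
      unfolding power_mult_distrib exp_of_nat_mult[symmetric] by simp
    have x: "real (Suc (K - 1)) / real K = 1" using K by simp
    show "of_real (sqrt (2 * pi)) / Gamma (of_real (real (Suc (K - 1)) / real K)) *
          exp (of_real (1/2 - real (Suc (K - 1)) / real K) * Ln (of_nat K * v)) *
          (\<Prod>r\<in>{..<K} - {K - 1}. exp (of_real (1/2 - real (Suc r) / real K) * Ln (1 - \<zeta> ^ Suc r))) *
          exp (- of_real (pi\<^sup>2) / (6 * of_nat K ^ 2 * v)) =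
       inverse (omega H K) * (of_real (sqrt (2 * pi)) * exp (- (1/2) * Ln (of_nat K * v))) *
         exp (- of_real (pi\<^sup>2) / (6 * of_nat K ^ 2 * v))"
      unfolding P x by simp
  qed
qed

section \<open>The reduced fraction behind F2\<close>

text \<open>Divide by g = gcd (k, t). If b does not divide k / g, the remaining numbers are coprime
  modulo both k / g and b. If it does, one factor b comes out of both; the rest can share at most
  one further b, and does so exactly under the congruence in the definition.\<close>

lemma lambda_mult_eq_gcd:
  assumes b: "prime b" and a: "coprime a (int b)" and t: "0 < t" and k: "0 < k" and hk: "coprime h k"
  shows "int (lambda_mult t a b h k) = gcd (int (h * b * t) + a * int k) (int (k * b))"
proof -
  define g where "g = gcd k t"
  have g: "0 < g" using t by (simp add: g_def)
  obtain k' t' where kt: "k = g * k'" "t = g * t'" and cop: "coprime k' t'"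
    using gcd_coprime_exists[of k t] g unfolding g_def by (auto simp: mult.commute)
  have k': "0 < k'" "k div g = k'" "h * t div g = h * t'" using k kt g by auto
  have hk': "coprime h k'" using hk kt by simp
  have b1: "\<not> b dvd 1" "0 < b" using b by (auto dest: prime_gt_0_nat)
  have k1: "k = 1 \<Longrightarrow> k' = 1" using kt by simp
  define B K' T' A where "B = int b" "K' = int k'" "T' = int t'" "A = int h"
  note defs = B_K'_T'_A_def
  have G: "gcd (int (h * b * t) + a * int k) (int (k * b)) = int g * gcd (A * B * T' + a * K') (K' * B)"
  proof -
    have "int (h * b * t) + a * int k = int g * (A * B * T' + a * K')" "int (k * b) = int g * (K' * B)"
      by (simp_all add: defs kt algebra_simps)
    then show ?thesis by (simp only: gcd_mult_left) simp
  qed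
  have copT: "coprime (A * T') K'" using hk' cop by (simp add: defs coprime_commute)
  show ?thesis
  proof (cases "b dvd k'")
    case False
    have bk: "coprime B K'" using prime_imp_coprime[OF b False] by (simp add: defs)
    have "coprime (A * B * T' + a * K') K'"
    proof -
      have "gcd K' (a * K' + A * B * T') = gcd K' (A * B * T')" by (rule gcd_add_mult)
      also have "\<dots> = 1" using copT bk by (simp add: coprime_iff_gcd_eq_1[symmetric] coprime_commute)
      finally show ?thesis by (simp add: coprime_iff_gcd_eq_1 gcd.commute add.commute)
    qed
    moreover have "coprime (A * B * T' + a * K') B"
    proof -
      have "gcd B ((A * T') * B + a * K') = gcd B (a * K')" by (rule gcd_add_mult)
      also have "\<dots> = 1" using a bk by (simp add: coprime_iff_gcd_eq_1[symmetric] coprime_commute defs)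
      finally show ?thesis by (simp add: coprime_iff_gcd_eq_1 gcd.commute mult_ac)
    qed
    ultimately have "gcd (A * B * T' + a * K') (K' * B) = 1" by simp
    moreover have "lambda_mult t a b h k = g"
      using False k1 k by (auto simp: lambda_mult_def Let_def g_def[symmetric] k')
    ultimately show ?thesis unfolding G by simp
  next
    case True
    then obtain k2 where k2: "k' = b * k2" by (rule dvdE)
    define K2 where "K2 = int k2"
    \<comment> \<open>This is h t / g + a k / (b g), the integer tested modulo b. It is coprime to
      \<open>K2\<close>, so its gcd with B \<open>K2\<close> is its gcd with B alone.\<close>
    define Y where "Y = A * T' + a * K2"
    have kk: "k div (b * g) = k2" using kt k2 g b1 by simp
    have "k \<noteq> 1" using True k1 b1 by auto
    then have lam: "lambda_mult t a b h k = g * (if \<not> B dvd Y then b else b ^ 2)"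
      using True k by (simp add: lambda_mult_def Let_def g_def[symmetric] k' kk cong_0_iff defs Y_def K2_def)
    have "gcd (A * B * T' + a * K') (K' * B) = gcd (B * Y) (B * (B * K2))"
      by (simp add: Y_def K2_def defs k2 algebra_simps)
    also have "\<dots> = B * gcd Y (B * K2)" by (simp add: gcd_mult_left defs)
    finally have G2: "gcd (A * B * T' + a * K') (K' * B) = B * gcd Y (B * K2)" .
    have YK: "coprime Y K2"
    proof -
      have "coprime (A * T') K2" using copT by (simp add: defs k2 K2_def)
      moreover have "gcd K2 (a * K2 + A * T') = gcd K2 (A * T')" by (rule gcd_add_mult)
      ultimately show ?thesis by (simp add: coprime_iff_gcd_eq_1 gcd.commute add.commute Y_def)
    qed
    have "gcd Y (B * K2) = (if \<not> B dvd Y then 1 else B)"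
    proof (cases "B dvd Y")
      case False
      have "prime B" using b by (simp add: defs)
      then have "coprime B Y" using False by (rule prime_imp_coprime)
      then show ?thesis using YK False by (simp add: coprime_commute)
    next
      case True
      then obtain Y' where Y': "Y = B * Y'" by (rule dvdE)
      then have "gcd Y' K2 = 1" using YK by simp
      then show ?thesis using True unfolding Y' gcd_mult_left by (simp add: defs)
    qed
    then show ?thesis unfolding G G2 lam by (simp add: defs power2_eq_square)
  qed
qed

lemma lambda_mult_pos: "0 < b \<Longrightarrow> 0 < t \<Longrightarrow> 0 < lambda_mult t a b h k"
  by (simp add: lambda_mult_def Let_def)

lemma omega_nonzero: "omega m n \<noteq> 0"
  by (simp add: omega_def Let_def)

lemma exp_close_imp_asymp_equiv:
  assumes "exp_close c f g" "S \<subseteq> wedge c" "\<And>w. w \<in> S \<Longrightarrow> w \<noteq> 0 \<Longrightarrow> g w \<noteq> 0"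
  shows "f \<sim>[at 0 within S] g"
proof (rule asymp_equivI')
  obtain E where E: "E \<in> O[at 0 within S](\<lambda>z. of_real (norm z))"
     "\<forall>\<^sub>F w in at 0 within S. f w = g w * (1 + E w)"
    using exp_close_imp_bigo[OF assms(1,2)] by blast
  have "((\<lambda>w. 1 + E w) \<longlongrightarrow> 1 + 0) (at 0 within S)"
    by (intro tendsto_intros bigo_norm_tendsto_0 E)
  moreover have "\<forall>\<^sub>F w in at 0 within S. w \<in> S \<and> w \<noteq> 0" by (auto simp: eventually_at_filter)
  with E(2) have "\<forall>\<^sub>F w in at 0 within S. 1 + E w = f w / g w"
    by eventually_elim (use assms(3) in auto)
  ultimately have "((\<lambda>w. f w / g w) \<longlongrightarrow> 1 + 0) (at 0 within S)"
    by (rule Lim_transform_eventually)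
  then show "((\<lambda>w. f w / g w) \<longlongrightarrow> 1) (at 0 within S)" by simp
qed

lemma coprime_exponent_of_primitive_root:
  assumes b: "prime b" and p: "primitive_unity_root b (exp (2 * of_real pi * \<i> * of_int a / of_nat b))"
  shows "coprime a (int b)"
proof (rule ccontr)
  assume "\<not> coprime a (int b)"
  then have "int b dvd a" using b prime_imp_coprime[of "int b" a] by (auto simp: coprime_commute)
  then obtain n where n: "a = int b * n" by (rule dvdE)
  have "0 < b" using b by (rule prime_gt_0_nat)
  then have "2 * of_real pi * \<i> * of_int a / of_nat b = (2 * of_int n * of_real pi) * \<i>"
    unfolding n by simp
  then have "exp (2 * of_real pi * \<i> * of_int a / of_nat b) = 1"
    using exp_integer_2pi[of "of_int n"] by simp
  then show False using p prime_gt_1_nat[OF b] unfolding primitive_unity_root_def by (auto dest: spec[of _ 1])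
qed

text \<open>Here \<xi> q^t = exp (2 pi i H / K) exp (- r z), where H / K is a / b + h t / k in
  lowest terms and r = 2 pi t / k. So the Euler product is evaluated at v = r z.\<close>

lemma F2_exp_close:
  fixes a :: int and b t h k :: nat
  assumes b: "prime b" and \<xi>: "\<xi> = exp (2 * of_real pi * \<i> * of_int a / of_nat b)"
    and p: "primitive_unity_root b \<xi>" and t: "0 < t" and hk: "h < k" "coprime h k" and c: "0 < c" "c \<le> 1"
  defines "l \<equiv> lambda_mult t a b h k"
  shows "exp_close c (\<lambda>z. F2 \<xi> (exp (2 * of_real pi * \<i> / of_nat k * (of_nat h + \<i> * z)) ^ t))
         (\<lambda>z. inverse (omega ((int (h * b * t) + a * int k) div int l) (k * b div l)) *
              (of_nat l / (of_nat t * of_nat b * z)) powr (1 / 2) *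
              exp (- (of_real pi * of_nat l ^ 2 / (12 * of_nat b ^ 2 * of_nat k * of_nat t * z))))"
proof -
  define N where "N = int (h * b * t) + a * int k"
  have b0: "0 < b" using b by (rule prime_gt_0_nat)
  have k0: "0 < k" using hk by simp
  have cop: "coprime a (int b)" using coprime_exponent_of_primitive_root[OF b] p \<xi> by simp
  have l: "int l = gcd N (int (k * b))"
    unfolding l_def N_def by (rule lambda_mult_eq_gcd[OF b cop t k0 hk(2)])
  have kb: "0 < k * b" using k0 b0 by simp
  have "0 < int l" unfolding l using kb by (simp add: gcd_pos_int)
  then have l0: "0 < l" by simp
  define H where "H = N div int l"
  define K where "K = k * b div l"
  have "int l dvd N" "int l dvd int (k * b)" unfolding l by auto
  then have "int l dvd N" "l dvd k * b" by (simp_all only: int_dvd_int_iff)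
  then have Hl: "N = H * int l" and Kl: "k * b = K * l" by (simp_all add: H_def K_def)
  have K0: "0 < K" using kb unfolding Kl by simp
  have "int K = int (k * b) div int l" by (simp add: K_def zdiv_int)
  then have HK: "coprime H (int K)"
    unfolding H_def l using kb by (simp add: div_gcd_coprime)
  define \<zeta> where "\<zeta> = exp (2 * of_real pi * \<i> * of_int H / of_nat K)"
  define r where "r = 2 * pi * real t / real k"
  have r: "0 < r" using t k0 by (simp add: r_def)
  have main: "exp_close c (\<lambda>z. \<Prod>n. 1 - (\<zeta> * exp (- (of_real r * z))) ^ Suc n)
    (\<lambda>z. inverse (omega H K) * (of_real (sqrt (2 * pi)) * exp (- (1/2) * Ln (of_nat K * (of_real r * z)))) *
         exp (- of_real (pi\<^sup>2) / (6 * of_nat K ^ 2 * (of_real r * z))))"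
    unfolding \<zeta>_def by (rule exp_close_scale[OF euler_product_exp_close[OF K0 HK c] r])
  have lc: "complex_of_nat k * of_nat b = of_nat K * of_nat l"
    using Kl by (metis of_nat_mult)
  show ?thesis
    unfolding N_def[symmetric] H_def[symmetric] K_def[symmetric]
  proof (rule exp_close_cong[OF main])
    fix z assume z: "z \<in> wedge c" "z \<noteq> 0"
    have "\<xi> * exp (2 * of_real pi * \<i> / of_nat k * (of_nat h + \<i> * z)) ^ t = \<zeta> * exp (- (of_real r * z))"
    proof -
      have "of_int H / of_nat K = (of_int N / (of_nat k * of_nat b) :: complex)"
        unfolding Hl lc using l0 K0 by simp
      then have "2 * of_real pi * \<i> * of_int H / of_nat K = 2 * of_real pi * \<i> * (of_int N / (of_nat k * of_nat b))"
        by (metis times_divide_eq_right)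
      also have "\<dots> = 2 * of_real pi * \<i> * of_int a / of_nat b + of_nat t * (2 * of_real pi * \<i> / of_nat k * of_nat h)"
        using k0 b0 by (simp add: N_def field_simps)
      finally have \<zeta>': "\<zeta> = \<xi> * exp (of_nat t * (2 * of_real pi * \<i> / of_nat k * of_nat h))"
        by (simp only: \<zeta>_def \<xi> exp_add)
      have "of_nat t * (2 * of_real pi * \<i> / of_nat k * (of_nat h + \<i> * z)) =
         of_nat t * (2 * of_real pi * \<i> / of_nat k * of_nat h) + - (of_real r * z)"
        using k0 by (simp add: r_def field_simps)
      then show ?thesis unfolding \<zeta>' exp_of_nat_mult[symmetric] by (simp only: exp_add mult.assoc)
    qed
    then show "(\<Prod>n. 1 - (\<zeta> * exp (- (of_real r * z))) ^ Suc n) =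
        F2 \<xi> (exp (2 * of_real pi * \<i> / of_nat k * (of_nat h + \<i> * z)) ^ t)"
      by (simp only: F2_def)
    \<comment> \<open>Chosen so that K r z = 2 pi y; the factor 2 pi then cancels against sqrt (2
      pi) and leaves y to the power -1/2. Since Re y > 0, inverting y commutes with Ln up to
      sign.\<close>
    define y where "y = of_nat t * of_nat b * z / of_nat l"
    have "y = of_real (real t * real b / real l) * z" by (simp add: y_def)
    then have "0 < Re y" using wedge_Re_pos[OF c(1) z] t b0 l0 by simp
    then have y: "y \<noteq> 0" "y \<notin> \<real>\<^sub>\<le>\<^sub>0" by (auto simp: complex_nonpos_Reals_iff)
    have Kr: "real K * r = 2 * pi * (real t * real b / real l)"
    proof -
      have "real k * real b = real K * real l" using Kl by (metis of_nat_mult)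
      then have "real K = real k * real b / real l" using l0 by (simp add: field_simps)
      then show ?thesis using k0 by (simp add: r_def)
    qed
    have "of_nat K * (of_real r * z) = of_real (real K * r) * z" by simp
    also have "\<dots> = of_real (2 * pi) * y" unfolding Kr by (simp add: y_def)
    finally have Ky: "of_nat K * (of_real r * z) = of_real (2 * pi) * y" .
    have "Ln (of_real (2 * pi) * y) = of_real (ln (2 * pi)) + Ln y"
      using Ln_times_of_real[of "2 * pi" y] Ln_of_real[of "2 * pi"] y by simp
    then have "- (1/2) * Ln (of_nat K * (of_real r * z)) = of_real (- (ln (2 * pi) / 2)) + 1/2 * Ln (inverse y)"
      unfolding Ky Ln_inverse[OF y(2)] by (simp add: algebra_simps)
    then have "exp (- (1/2) * Ln (of_nat K * (of_real r * z))) = of_real (exp (- (ln (2 * pi) / 2))) * exp (1/2 * Ln (inverse y))"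
      by (simp only: exp_add exp_of_real)
    moreover have "exp (- (ln (2 * pi) / 2)) = inverse (sqrt (2 * pi))"
      by (simp add: exp_minus ln_sqrt[symmetric])
    moreover have "inverse y = of_nat l / (of_nat t * of_nat b * z)" by (simp add: y_def)
    moreover have "inverse y powr (1/2) = exp (1/2 * Ln (inverse y))" using y by (simp add: powr_def)
    ultimately have 1: "of_real (sqrt (2 * pi)) * exp (- (1/2) * Ln (of_nat K * (of_real r * z))) =
        (of_nat l / (of_nat t * of_nat b * z)) powr (1 / 2)"
      by simp
    have "6 * of_nat K ^ 2 * (of_real r * z) = 6 * of_nat K * (of_nat K * (of_real r * z))"
      by (simp add: power2_eq_square)
    also have "\<dots> = 6 * of_nat K * (of_real (2 * pi) * y)" unfolding Ky ..
    also have "\<dots> = 12 * of_real pi * (of_nat K * of_nat l) * of_nat t * of_nat b * z / of_nat l ^ 2"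
      using l0 by (simp add: y_def power2_eq_square)
    also have "\<dots> = 12 * of_real pi * of_nat b ^ 2 * of_nat k * of_nat t * z / of_nat l ^ 2"
      unfolding lc[symmetric] by (simp add: power2_eq_square)
    finally have 2: "- of_real (pi\<^sup>2) / (6 * of_nat K ^ 2 * (of_real r * z)) =
        - (of_real pi * of_nat l ^ 2 / (12 * of_nat b ^ 2 * of_nat k * of_nat t * z))"
      by (simp add: power2_eq_square)
    show "inverse (omega H K) * (of_real (sqrt (2 * pi)) * exp (- (1/2) * Ln (of_nat K * (of_real r * z)))) *
         exp (- of_real (pi\<^sup>2) / (6 * of_nat K ^ 2 * (of_real r * z))) =
       inverse (omega H K) * (of_nat l / (of_nat t * of_nat b * z)) powr (1 / 2) *
              exp (- (of_real pi * of_nat l ^ 2 / (12 * of_nat b ^ 2 * of_nat k * of_nat t * z)))"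
      unfolding 1 2 ..
  qed
qed

theorem theorem2p1:
  fixes b :: nat and \<xi> :: complex and \<theta> :: real
  assumes "0 < b"
    and "primitive_unity_root b \<xi>"
    and "0 \<le> \<theta>" and "\<theta> < pi / 2"
  shows
    "(\<xi> \<noteq> 1 \<longrightarrow>
       (\<exists>E :: complex \<Rightarrow> complex.
          E \<in> O[at 0 within sector \<theta>](\<lambda>z. of_real (norm z)) \<and>
          (\<forall>\<^sub>F z in at 0 within sector \<theta>.
             F1 \<xi> (exp (- z)) =
               1 / csqrt (1 - \<xi>) * exp (- (\<xi> * lerch_phi \<xi> 2 1 / z)) * (1 + E z))))
     \<and>
     (\<forall>(a::int) (t::nat) (h::nat) (k::nat).
        prime b \<and> odd b \<and> \<xi> = exp (2 * of_real pi * \<i> * of_int a / of_nat b) \<and>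
        0 < t \<and> h < k \<and> coprime h k \<longrightarrow>
        (let l = lambda_mult t a b h k in
         (\<lambda>z. F2 \<xi> (exp (2 * of_real pi * \<i> / of_nat k * (of_nat h + \<i> * z)) ^ t))
           \<sim>[at 0 within (sector \<theta> \<inter> {z. Re z > 0})]
         (\<lambda>z. inverse (omega ((int (h * b * t) + a * int k) div int l) (k * b div l)) *
              (of_nat l / (of_nat t * of_nat b * z)) powr (1 / 2) *
              exp (- (of_real pi * of_nat l ^ 2 / (12 * of_nat b ^ 2 * of_nat k * of_nat t * z))))))
     \<and>
     (\<exists>E :: complex \<Rightarrow> complex.
        E \<in> O[at 0 within sector \<theta>](\<lambda>z. of_real (norm z)) \<and>
        (\<forall>\<^sub>F z in at 0 within sector \<theta>.
           F3 \<xi> (exp (- z)) =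
             of_real (sqrt (2 * pi)) * (of_nat b ^ 2 * z) powr (1 / 2 - 1 / of_nat b)
               / Gamma (1 / of_nat b)
             * (\<Prod>j = 1..b - 1. 1 / (1 - \<xi> ^ j) powr (of_nat j / of_nat b))
             * exp (- (of_real pi ^ 2 / (6 * of_nat b ^ 2 * z)))
             * (1 + E z)))"
proof (intro conjI impI allI, goal_cases)
  case 1
  have "norm \<xi> = 1" using assms(2) by (rule norm_primitive_unity_root)
  from exp_close_imp_bigo[OF F1_exp_close[OF this 1] sector_subset_wedge[OF assms(3,4)]]
  show ?case using cos_gt_zero_pi[of \<theta>] assms(3,4) by simp
next
  case (2 a t h k)
  define l where "l = lambda_mult t a b h k"
  have c: "0 < cos \<theta>" using cos_gt_zero_pi[of \<theta>] assms(3,4) by simp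
  have "exp_close (cos \<theta>) (\<lambda>z. F2 \<xi> (exp (2 * of_real pi * \<i> / of_nat k * (of_nat h + \<i> * z)) ^ t))
         (\<lambda>z. inverse (omega ((int (h * b * t) + a * int k) div int l) (k * b div l)) *
              (of_nat l / (of_nat t * of_nat b * z)) powr (1 / 2) *
              exp (- (of_real pi * of_nat l ^ 2 / (12 * of_nat b ^ 2 * of_nat k * of_nat t * z))))"
    unfolding l_def by (rule F2_exp_close) (use 2 assms(2) c in auto)
  moreover have "sector \<theta> \<inter> {z. Re z > 0} \<subseteq> wedge (cos \<theta>)"
    using sector_subset_wedge[OF assms(3,4)] by blast
  moreover have "0 < l" using 2 assms(1) by (simp add: l_def lambda_mult_pos)
  ultimately show ?case
    unfolding Let_def l_def[symmetric] using 2 assms(1)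
    by (intro exp_close_imp_asymp_equiv) (auto simp: omega_nonzero)
next
  case 3
  have "0 < cos \<theta>" using cos_gt_zero_pi[of \<theta>] assms(3,4) by simp
  from exp_close_imp_bigo[OF F3_exp_close[OF assms(2) this cos_le_one] sector_subset_wedge[OF assms(3,4)]]
  show ?case .
qed

end
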